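(* There exist a bounded domain $\Omega'\subset\mathbb{R}^2$, a $2$-John domain $\Omega\subset\mathbb{R}^2$, and a quasiconformal mapping $f:\Omega'\to\Omega$ (a homeomorphism of $\Omega'$ onto $\Omega$) such that $f$ is not uniformly continuous with respect to the Euclidean metric $d(x,y)=|x-y|$ in $\Omega$ and the internal metric $d_I$ in $\Omega'$; that is, $f:(\Omega',d_I)\to(\Omega,|\cdot|)$ is not uniformly continuous.
   Context: A domain is a nonempty open connected set. For $s\ge 1$, a bounded domain $\Omega\subset\mathbb{R}^n$ is an $s$-John domain if there are a constant $C$ and a point $x_0\in\Omega$ so that for each $x\in\Omega$ one can find a rectifiable curve $\gamma:[0,1]\to\Omega$ with $\gamma(0)=x$, $\gamma(1)=x_0$ and $$C\,d(\gamma(t),\partial\Omega)\ge l(\gamma([0,t]))^s\quad\text{for each } 0<t\le 1,$$ where $l$ denotes length and $d(\cdot,\partial\Omega)$ is the Euclidean distance to the boundary. For a domain $G\subset\mathbb{R}^n$ and $z,w\in G$, the internal distance $d_I(z,w)$ is the infimum of the lengths of all paths that join $z$ to $w$ in $G$. A quasiconformal mapping is a homeomorphism between domains that is $K$-quasiconformal for some $K\ge1$ in the usual sense. *)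

theory Defs
  imports "HOL-Analysis.Analysis"
begin

definition is_domain :: "'a::topological_space set \<Rightarrow> bool"
  where "is_domain D \<longleftrightarrow> D \<noteq> {} \<and> open D \<and> connected D"

(* Length of the restriction of g to [a,b]: supremum of the polygonal sums over
   all finite increasing sequences of parameters.  The value may be infinite. *)
definition curve_length :: "real \<Rightarrow> real \<Rightarrow> (real \<Rightarrow> 'a::metric_space) \<Rightarrow> ennreal"
  where "curve_length a b g =
    (SUP ts \<in> {ts. sorted ts \<and> set ts \<subseteq> {a..b}}.
       ennreal (\<Sum>i<length ts - 1. dist (g (ts ! i)) (g (ts ! Suc i))))"

definition rectifiable :: "(real \<Rightarrow> 'a::metric_space) \<Rightarrow> bool"
  where "rectifiable g \<longleftrightarrow> curve_length 0 1 g < \<infinity>"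

(* enn2real is only applied to finite lengths here, because g is rectifiable. *)
definition John_domain :: "real \<Rightarrow> 'a::euclidean_space set \<Rightarrow> bool"
  where "John_domain s D \<longleftrightarrow>
    s \<ge> 1 \<and> is_domain D \<and> bounded D \<and>
    (\<exists>C::real. \<exists>x0\<in>D. \<forall>x\<in>D. \<exists>g.
       path g \<and> path_image g \<subseteq> D \<and> pathstart g = x \<and> pathfinish g = x0 \<and> rectifiable g \<and>
       (\<forall>t. 0 < t \<and> t \<le> 1 \<longrightarrow>
          C * infdist (g t) (frontier D) \<ge> enn2real (curve_length 0 t g) powr s))"

(* Non-rectifiable paths contribute infinity and so do not affect the infimum. *)
definition internal_dist :: "'a::metric_space set \<Rightarrow> 'a \<Rightarrow> 'a \<Rightarrow> ennreal"
  where "internal_dist G z w =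
    (INF g \<in> {g. path g \<and> path_image g \<subseteq> G \<and> pathstart g = z \<and> pathfinish g = w}.
       curve_length 0 1 g)"

(* The families of non-overlapping subintervals of [a,b] in the usual epsilon-delta
   definition are the divisions of subsets of [a,b]. *)
definition absolutely_continuous_on_interval ::
    "real \<Rightarrow> real \<Rightarrow> (real \<Rightarrow> 'a::metric_space) \<Rightarrow> bool"
  where "absolutely_continuous_on_interval a b h \<longleftrightarrow>
    (\<forall>\<epsilon>>0. \<exists>\<delta>>0. \<forall>\<D> T. \<D> division_of T \<and> T \<subseteq> {a..b} \<and> (\<Sum>I\<in>\<D>. (Sup I - Inf I)) < \<delta>
       \<longrightarrow> (\<Sum>I\<in>\<D>. dist (h (Inf I)) (h (Sup I))) < \<epsilon>)"

(* Absolutely continuous on lines: on every closed rectangle contained in D, f is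
   absolutely continuous on almost every horizontal and almost every vertical segment. *)
definition ACL :: "(real^2) set \<Rightarrow> (real^2 \<Rightarrow> real^2) \<Rightarrow> bool"
  where "ACL D f \<longleftrightarrow> continuous_on D f \<and>
    (\<forall>a b. cbox a b \<subseteq> D \<longrightarrow>
       (AE y in lebesgue. y \<in> {a$2..b$2} \<longrightarrow>
          absolutely_continuous_on_interval (a$1) (b$1) (\<lambda>x. f (vector [x, y]))) \<and>
       (AE x in lebesgue. x \<in> {a$1..b$1} \<longrightarrow>
          absolutely_continuous_on_interval (a$2) (b$2) (\<lambda>y. f (vector [x, y]))))"

(* Analytic definition of K-quasiconformality in the plane: an ACL homeomorphism that is
   differentiable almost everywhere with |Df|^2 <= K |J_f| almost everywhere.
   As in Vaisala's book, orientation-reversing maps are allowed. *)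
definition K_quasiconformal ::
    "real \<Rightarrow> (real^2) set \<Rightarrow> (real^2) set \<Rightarrow> (real^2 \<Rightarrow> real^2) \<Rightarrow> bool"
  where "K_quasiconformal K D D' f \<longleftrightarrow>
    K \<ge> 1 \<and> is_domain D \<and> is_domain D' \<and> (\<exists>g. homeomorphism D D' f g) \<and> ACL D f \<and>
    (AE x in lebesgue. x \<in> D \<longrightarrow>
       (\<exists>f'. (f has_derivative f') (at x) \<and> (onorm f')\<^sup>2 \<le> K * \<bar>det (matrix f')\<bar>))"

definition quasiconformal ::
    "(real^2) set \<Rightarrow> (real^2) set \<Rightarrow> (real^2 \<Rightarrow> real^2) \<Rightarrow> bool"
  where "quasiconformal D D' f \<longleftrightarrow> (\<exists>K\<ge>1. K_quasiconformal K D D' f)"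

definition uniformly_continuous_internal ::
    "'a::metric_space set \<Rightarrow> ('a \<Rightarrow> 'b::metric_space) \<Rightarrow> bool"
  where "uniformly_continuous_internal G f \<longleftrightarrow>
    (\<forall>\<epsilon>>0. \<exists>\<delta>>0. \<forall>x\<in>G. \<forall>y\<in>G.
       internal_dist G x y < ennreal \<delta> \<longrightarrow> dist (f x) (f y) < \<epsilon>)"

end

theory Submission
  imports Defs
begin

text \<open>
  Write \<open>h = 1/2^j\<close>. The \<open>2\<close>-John domain is a grid of horizontal rooms of length \<open>2\<close> and width
  comparable to \<open>h^2\<close> at the heights \<open>h\<close>; consecutive rooms are joined by about \<open>1/h\<close> vertical
  corridors of length \<open>h/2\<close> and width comparable to \<open>h^2\<close>, spaced \<open>h\<close> apart. From height \<open>h\<close> one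
  climbs out along a curve of length \<open>O(h)\<close> that keeps distance at least \<open>c h^2\<close> from the boundary.
  The inverse of the quasiconformal map acts on the rooms by
  \<open>(x, y) \<mapsto> (\<Phi> x, h + \<Phi>' x * (y - h))\<close>. Here \<open>\<Phi>' = 1\<close> where corridors are attached, and between two
  of them \<open>\<Phi>'\<close> drops to order \<open>h^4\<close>, subject to the bound \<open>\<bar>\<Phi>''\<bar> h^2 \<le> C \<Phi>'\<close> that
  quasiconformality requires. So each cell of length \<open>h\<close> shrinks to length \<open>O(h^2)\<close>, and the whole
  room to length \<open>O(h)\<close>. Since consecutive rooms shrink by different factors, the corridors are
  sheared, with slopes that stay bounded. Hence the segment from \<open>(0, h)\<close> to \<open>(1/2, h)\<close> comes from
  a segment of length \<open>O(h)\<close>, for every \<open>h\<close>.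
\<close>

section \<open>Lengths, Lipschitz maps and quasiconformality\<close>

lemma curve_length_lipschitz:
  fixes g :: "real \<Rightarrow> 'a::metric_space"
  assumes "a \<le> b" "0 \<le> L"
    and lip: "\<And>s t. a \<le> s \<Longrightarrow> s \<le> t \<Longrightarrow> t \<le> b \<Longrightarrow> dist (g s) (g t) \<le> L * (t - s)"
  shows "curve_length a b g \<le> ennreal (L * (b - a))"
  unfolding curve_length_def
proof (rule SUP_least)
  fix ts :: "real list"
  assume "ts \<in> {ts. sorted ts \<and> set ts \<subseteq> {a..b}}"
  then have s: "sorted ts" and sub: "set ts \<subseteq> {a..b}" by auto
  have "(\<Sum>i<length ts - 1. dist (g (ts ! i)) (g (ts ! Suc i))) \<le> L * (b - a)"
  proof (cases "ts = []")
    case True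
    then show ?thesis using assms by simp
  next
    case False
    have nth: "ts ! i \<in> {a..b}" if "i < length ts" for i
      using sub nth_mem[OF that] by blast
    have "(\<Sum>i<length ts - 1. dist (g (ts ! i)) (g (ts ! Suc i)))
        \<le> (\<Sum>i<length ts - 1. L * (ts ! Suc i - ts ! i))"
    proof (rule sum_mono)
      fix i assume "i \<in> {..<length ts - 1}"
      then have i: "Suc i < length ts" by auto
      show "dist (g (ts ! i)) (g (ts ! Suc i)) \<le> L * (ts ! Suc i - ts ! i)"
        using nth[of i] nth[OF i] i sorted_nth_mono[OF s, of i "Suc i"] by (intro lip) auto
    qed
    also have "\<dots> = L * (ts ! (length ts - 1) - ts ! 0)"
      by (simp add: sum_distrib_left[symmetric] sum_lessThan_telescope)
    also have "\<dots> \<le> L * (b - a)"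
      using nth[of 0] nth[of "length ts - 1"] False \<open>0 \<le> L\<close> by (intro mult_left_mono) auto
    finally show ?thesis .
  qed
  then show "ennreal (\<Sum>i<length ts - 1. dist (g (ts ! i)) (g (ts ! Suc i))) \<le> ennreal (L * (b - a))"
    by (rule ennreal_leI)
qed

lemma absolutely_continuous_lipschitz:
  fixes h :: "real \<Rightarrow> 'a::metric_space"
  assumes lip: "\<And>s t. s \<in> {a..b} \<Longrightarrow> t \<in> {a..b} \<Longrightarrow> dist (h s) (h t) \<le> L * dist s t"
  shows "absolutely_continuous_on_interval a b h"
  unfolding absolutely_continuous_on_interval_def
proof (intro allI impI)
  fix e :: real
  assume e: "e > 0"
  \<comment> \<open>A strictly positive factor, whatever the sign of \<open>L\<close>, so that
    \<open>e / M\<close> can serve as delta.\<close>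
  define M where "M = max L 0 + 1"
  have M: "M > 0" "L \<le> M" by (auto simp: M_def)
  show "\<exists>\<delta>>0. \<forall>\<D> T. \<D> division_of T \<and> T \<subseteq> {a..b} \<and> (\<Sum>I\<in>\<D>. Sup I - Inf I) < \<delta>
       \<longrightarrow> (\<Sum>I\<in>\<D>. dist (h (Inf I)) (h (Sup I))) < e"
  proof (intro exI[of _ "e / M"] conjI allI impI)
    show "e / M > 0" using e M by simp
    fix \<D> :: "real set set" and T
    assume *: "\<D> division_of T \<and> T \<subseteq> {a..b} \<and> (\<Sum>I\<in>\<D>. Sup I - Inf I) < e / M"
    have "(\<Sum>I\<in>\<D>. dist (h (Inf I)) (h (Sup I))) \<le> (\<Sum>I\<in>\<D>. M * (Sup I - Inf I))"
    proof (rule sum_mono)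
      fix I assume I: "I \<in> \<D>"
      then have sub: "I \<subseteq> {a..b}" and ne: "I \<noteq> {}"
        using * division_ofD(2,3) by blast+
      obtain u v where uv: "I = cbox u v" using * I division_ofD(4) by blast
      then have le: "u \<le> v" and I': "I = {u..v}" using ne by auto
      then have ie: "Inf I = u" "Sup I = v" by auto
      have "dist (h u) (h v) \<le> L * (v - u)"
        using lip[of u v] sub le I' by (auto simp: dist_real_def)
      also have "\<dots> \<le> M * (v - u)" using M le by (intro mult_right_mono) auto
      finally show "dist (h (Inf I)) (h (Sup I)) \<le> M * (Sup I - Inf I)" by (simp add: ie)
    qed
    also have "\<dots> = M * (\<Sum>I\<in>\<D>. Sup I - Inf I)" by (simp add: sum_distrib_left)
    also have "\<dots> < M * (e / M)" using * M by (intro mult_strict_left_mono) auto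
    finally show "(\<Sum>I\<in>\<D>. dist (h (Inf I)) (h (Sup I))) < e" using M by simp
  qed
qed

text \<open>Inside a rectangle the restriction to each horizontal or vertical segment is Lipschitz,
  so absolute continuity holds on every segment, not just on almost every one.\<close>

lemma ACL_lipschitz:
  assumes cont: "continuous_on D f"
    and lip: "\<And>a b. cbox a b \<subseteq> D \<Longrightarrow> \<exists>L. \<forall>p\<in>cbox a b. \<forall>q\<in>cbox a b. dist (f p) (f q) \<le> L * dist p q"
  shows "ACL D f"
  unfolding ACL_def
proof (intro conjI allI impI cont)
  fix a b :: "real^2"
  assume "cbox a b \<subseteq> D"
  then obtain L where L: "\<And>p q. p \<in> cbox a b \<Longrightarrow> q \<in> cbox a b \<Longrightarrow> dist (f p) (f q) \<le> L * dist p q"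
    using lip by blast
  have d1: "dist (vector [s, y] :: real^2) (vector [t, y]) = dist s t" for s t y :: real
    by (simp add: dist_norm norm_vec_def L2_set_def sum_2)
  have d2: "dist (vector [y, s] :: real^2) (vector [y, t]) = dist s t" for s t y :: real
    by (simp add: dist_norm norm_vec_def L2_set_def sum_2)
  have c: "(vector [x, y] :: real^2) \<in> cbox a b \<longleftrightarrow> x \<in> {a$1..b$1} \<and> y \<in> {a$2..b$2}" for x y
    by (auto simp: mem_box_cart forall_2)
  have "absolutely_continuous_on_interval (a$1) (b$1) (\<lambda>x. f (vector [x, y]))"
    if "y \<in> {a$2..b$2}" for y
  proof (rule absolutely_continuous_lipschitz)
    fix s t assume "s \<in> {a$1..b$1}" "t \<in> {a$1..b$1}"
    then show "dist (f (vector [s, y])) (f (vector [t, y])) \<le> L * dist s t"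
      using L[of "vector [s, y]" "vector [t, y]"] that by (simp add: c d1)
  qed
  then show "AE y in lebesgue. y \<in> {a$2..b$2} \<longrightarrow>
          absolutely_continuous_on_interval (a$1) (b$1) (\<lambda>x. f (vector [x, y]))"
    by simp
  have "absolutely_continuous_on_interval (a$2) (b$2) (\<lambda>y. f (vector [x, y]))"
    if "x \<in> {a$1..b$1}" for x
  proof (rule absolutely_continuous_lipschitz)
    fix s t assume "s \<in> {a$2..b$2}" "t \<in> {a$2..b$2}"
    then show "dist (f (vector [x, s])) (f (vector [x, t])) \<le> L * dist s t"
      using L[of "vector [x, s]" "vector [x, t]"] that by (simp add: c d2)
  qed
  then show "AE x in lebesgue. x \<in> {a$1..b$1} \<longrightarrow>
          absolutely_continuous_on_interval (a$2) (b$2) (\<lambda>y. f (vector [x, y]))"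
    by simp
qed

section \<open>Derivatives with equal diagonal entries and quasiconformality of an inverse
  map\<close>

definition lin2 :: "real \<Rightarrow> real \<Rightarrow> real \<Rightarrow> real^2 \<Rightarrow> real^2"
  where "lin2 l m n v = vector [l * v$1 + m * v$2, n * v$1 + l * v$2]"

lemma vector2_eq_axis: "(vector [a, b] :: real^2) = a *\<^sub>R axis 1 1 + b *\<^sub>R axis 2 1"
  by (simp add: vec_eq_iff forall_2 axis_def)

lemma linear_lin2: "linear (lin2 l m n)"
  by (rule linearI) (simp_all add: lin2_def vec_eq_iff forall_2 algebra_simps)

text \<open>\<open>lin2 l m n\<close> is \<open>l I + N\<close>, where \<open>N\<close> carries the
  off-diagonal entries \<open>m\<close> and \<open>n\<close>. Since \<open>m * n = 0\<close>,
  \<open>N\<close> squares to zero, and the inverse is \<open>(1/l) I - (1/l^2) N\<close>.\<close>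

lemma lin2_inverse:
  assumes "l \<noteq> 0" "m * n = 0"
  shows "lin2 l m n \<circ> lin2 (1 / l) (- m / l\<^sup>2) (- n / l\<^sup>2) = id"
proof
  fix v
  have "m = 0 \<or> n = 0" using assms by auto
  then show "(lin2 l m n \<circ> lin2 (1 / l) (- m / l\<^sup>2) (- n / l\<^sup>2)) v = id v"
    using \<open>l \<noteq> 0\<close> by (auto simp: lin2_def vec_eq_iff forall_2 field_simps power2_eq_square)
qed

lemma det_lin2: "det (matrix (lin2 l m n)) = l\<^sup>2 - m * n"
  by (simp add: det_2 matrix_def lin2_def axis_def power2_eq_square)

lemma onorm_lin2:
  assumes "0 < l" "\<bar>m\<bar> \<le> M * l" "\<bar>n\<bar> \<le> M * l"
  shows "onorm (lin2 l m n) \<le> (1 + 2 * M) * l"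
proof (rule onorm_bound)
  have "0 \<le> M * l" using assms by linarith
  then show "0 \<le> (1 + 2 * M) * l" using assms(1) by (simp add: algebra_simps)
  fix v :: "real^2"
  have c: "\<bar>v$1\<bar> \<le> norm v" "\<bar>v$2\<bar> \<le> norm v" by (rule component_le_norm_cart)+
  have eq: "lin2 l m n v = l *\<^sub>R v + ((m * v$2) *\<^sub>R axis 1 1 + (n * v$1) *\<^sub>R axis 2 1)"
    by (simp add: lin2_def vec_eq_iff forall_2 axis_def)
  have "norm (lin2 l m n v) \<le> norm (l *\<^sub>R v) + (norm ((m * v$2) *\<^sub>R axis 1 1 :: real^2)
      + norm ((n * v$1) *\<^sub>R axis 2 1 :: real^2))"
    unfolding eq by (intro norm_triangle_le add_left_mono norm_triangle_ineq)
  also have "\<dots> = l * norm v + (\<bar>m\<bar> * \<bar>v$2\<bar> + \<bar>n\<bar> * \<bar>v$1\<bar>)"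
    using assms(1) by (simp add: abs_mult)
  also have "\<dots> \<le> l * norm v + ((M * l) * norm v + (M * l) * norm v)"
    using assms c \<open>0 \<le> M * l\<close> by (intro add_left_mono add_mono mult_mono) auto
  finally show "norm (lin2 l m n v) \<le> (1 + 2 * M) * l * norm v" by (simp add: algebra_simps)
qed

text \<open>The inverse has derivatives of the same shape, with \<open>1/l\<close> on the diagonal
  and the same ratio bound \<open>M\<close>; the determinant is the square of the diagonal entry, so
  dilatation is bounded in terms of \<open>M\<close> alone. The factor \<open>l\<close> may tend to
  zero at the boundary. The continuous lower bound \<open>c\<close> controls it on compact sets,
  which makes the inverse Lipschitz on rectangles and hence ACL.\<close>

lemma quasiconformal_inverse:
  fixes g :: "real^2 \<Rightarrow> real^2" and c :: "real^2 \<Rightarrow> real"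
  assumes dom: "is_domain D" and inj: "inj_on g D"
    and c: "continuous_on D c" "\<And>z. z \<in> D \<Longrightarrow> 0 < c z"
    and der: "\<And>z. z \<in> D \<Longrightarrow> \<exists>l m n. (g has_derivative lin2 l m n) (at z) \<and> m * n = 0 \<and>
      \<bar>m\<bar> \<le> M * l \<and> \<bar>n\<bar> \<le> M * l \<and> c z \<le> l"
  shows "is_domain (g ` D)" "quasiconformal (g ` D) D (inv_into D g)"
proof -
  define f where "f = inv_into D g"
  have oD: "open D" and cD: "connected D" and neD: "D \<noteq> {}" using dom by (auto simp: is_domain_def)
  have contg: "continuous_on D g"
    using der has_derivative_continuous continuous_at_imp_continuous_on by metis
  have fg: "f (g z) = z" if "z \<in> D" for z using that inj by (simp add: f_def)
  obtain f' where f': "homeomorphism D (g ` D) g f'"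
    using invariance_of_domain_homeomorphism[OF oD contg _ inj] by auto
  have homeo: "homeomorphism (g ` D) D f g"
  proof (rule homeomorphism_sym[THEN iffD1])
    show "homeomorphism D (g ` D) g f"
      by (rule homeomorphism_cong[OF f']) (use f' fg in \<open>auto simp: homeomorphism_def\<close>)
  qed
  have contf: "continuous_on (g ` D) f" using homeo by (simp add: homeomorphism_def)
  have "open (g ` D)" by (rule invariance_of_domain[OF contg oD inj])
  moreover have "connected (g ` D)" by (rule connected_continuous_image[OF contg cD])
  ultimately show dom': "is_domain (g ` D)" using neD by (simp add: is_domain_def)
  have derf: "\<exists>l m n. (f has_derivative lin2 l m n) (at p) \<and> m * n = 0 \<and>
      \<bar>m\<bar> \<le> M * l \<and> \<bar>n\<bar> \<le> M * l \<and> 0 < l \<and> l \<le> 1 / c (f p)" if p: "p \<in> g ` D" for p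
  proof -
    obtain z where z: "z \<in> D" "p = g z" using p by auto
    obtain l m n where d: "(g has_derivative lin2 l m n) (at z)" "m * n = 0"
      "\<bar>m\<bar> \<le> M * l" "\<bar>n\<bar> \<le> M * l" "c z \<le> l" using der[OF z(1)] by blast
    have l: "0 < l" using c(2)[OF z(1)] d(5) by linarith
    have "(f has_derivative lin2 (1 / l) (- m / l\<^sup>2) (- n / l\<^sup>2)) (at p)"
      unfolding z(2)
      by (rule has_derivative_inverse_strong[OF oD z(1) contg fg d(1) lin2_inverse])
        (use l d in auto)
    moreover have "\<bar>x / l\<^sup>2\<bar> \<le> M * (1 / l)" if "\<bar>x\<bar> \<le> M * l" for x
      using that l by (simp add: field_simps power2_eq_square)
    moreover have "1 / l \<le> 1 / c (f p)" using c(2)[OF z(1)] d(5) l z fg by (simp add: frac_le)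
    ultimately show ?thesis using l d
      by (intro exI[of _ "1 / l"] exI[of _ "- m / l\<^sup>2"] exI[of _ "- n / l\<^sup>2"]) auto
  qed
  have ACL: "ACL (g ` D) f"
  proof (rule ACL_lipschitz[OF contf])
    fix a b :: "real^2"
    assume sub: "cbox a b \<subseteq> g ` D"
    have "continuous_on (cbox a b) (\<lambda>p. 1 / c (f p))"
    proof (intro continuous_intros)
      show "continuous_on (cbox a b) (\<lambda>p. c (f p))"
        by (rule continuous_on_compose2[OF c(1) continuous_on_subset[OF contf sub]]) (use sub fg in auto)
      show "\<forall>p\<in>cbox a b. c (f p) \<noteq> 0" using sub fg c(2) by fastforce
    qed
    then have "bounded ((\<lambda>p. 1 / c (f p)) ` cbox a b)"
      by (intro compact_imp_bounded compact_continuous_image) auto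
    then obtain C where C: "\<And>p. p \<in> cbox a b \<Longrightarrow> \<bar>1 / c (f p)\<bar> \<le> C"
      by (auto simp: bounded_iff)
    \<comment> \<open>A uniform bound on the derivative over the convex rectangle becomes a
      Lipschitz constant by the mean value inequality.\<close>
    have "\<exists>f'. (f has_derivative f') (at p within cbox a b) \<and> onorm f' \<le> \<bar>1 + 2 * M\<bar> * C"
      if p: "p \<in> cbox a b" for p
    proof -
      obtain l m n where d: "(f has_derivative lin2 l m n) (at p)"
        "\<bar>m\<bar> \<le> M * l" "\<bar>n\<bar> \<le> M * l" "0 < l" "l \<le> 1 / c (f p)" using derf[OF subsetD[OF sub p]] by blast
      have "onorm (lin2 l m n) \<le> (1 + 2 * M) * l" by (rule onorm_lin2[OF d(4,2,3)])
      also have "\<dots> \<le> \<bar>1 + 2 * M\<bar> * C"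
        using abs_le_D1[OF C[OF p]] d(4,5) by (intro mult_mono) auto
      finally show ?thesis using d(1) has_derivative_at_withinI by blast
    qed
    then obtain F where F: "\<And>p. p \<in> cbox a b \<Longrightarrow> (f has_derivative F p) (at p within cbox a b)"
      "\<And>p. p \<in> cbox a b \<Longrightarrow> onorm (F p) \<le> \<bar>1 + 2 * M\<bar> * C" by metis
    show "\<exists>L. \<forall>p\<in>cbox a b. \<forall>q\<in>cbox a b. dist (f p) (f q) \<le> L * dist p q"
      using differentiable_bound[OF convex_box(1) F] by (auto simp: dist_norm)
  qed
  \<comment> \<open>The extra summand 1 in the dilatation guarantees \<open>K >= 1\<close> for every
    \<open>M\<close>.\<close>
  have "\<exists>f'. (f has_derivative f') (at p) \<and> (onorm f')\<^sup>2 \<le> (1 + (1 + 2 * M)\<^sup>2) * \<bar>det (matrix f')\<bar>"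
    if p: "p \<in> g ` D" for p
  proof -
    obtain l m n where d: "(f has_derivative lin2 l m n) (at p)" "m * n = 0"
      "\<bar>m\<bar> \<le> M * l" "\<bar>n\<bar> \<le> M * l" "0 < l" using derf[OF p] by blast
    have "(onorm (lin2 l m n))\<^sup>2 \<le> ((1 + 2 * M) * l)\<^sup>2"
      by (intro power_mono onorm_lin2 onorm_pos_le linear_conv_bounded_linear[THEN iffD1] linear_lin2 d)
    also have "\<dots> \<le> (1 + (1 + 2 * M)\<^sup>2) * l\<^sup>2"
      by (simp only: power_mult_distrib) (intro mult_right_mono, auto)
    finally show ?thesis using d by (auto simp: det_lin2)
  qed
  then have "K_quasiconformal (1 + (1 + 2 * M)\<^sup>2) (g ` D) D f"
    unfolding K_quasiconformal_def using dom dom' homeo ACL by auto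
  then show "quasiconformal (g ` D) D (inv_into D g)"
    unfolding quasiconformal_def f_def[symmetric] by (intro exI[of _ "1 + (1 + 2 * M)\<^sup>2"]) auto
qed

section \<open>The profile of a periodically narrowing room\<close>

text \<open>Squaring removes the corner of the positive part: at 0 the difference quotient is at
  most \<open>|h|\<close>. Both the spline and the room profile are built from this
  function.\<close>

lemma pos_sq_deriv:
  "((\<lambda>x::real. (max 0 x)\<^sup>2) has_field_derivative 2 * max 0 x) (at x)"
proof (cases x "0 :: real" rule: linorder_cases)
  case less
  have "((\<lambda>x::real. 0) has_field_derivative 0) (at x)" by simp
  then have "((\<lambda>x::real. (max 0 x)\<^sup>2) has_field_derivative 0) (at x)"
    by (rule has_field_derivative_transform_within_open[where S = "{..<0}"]) (use less in auto)
  then show ?thesis using less by simp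
next
  case greater
  have "((\<lambda>x::real. x\<^sup>2) has_field_derivative 2 * x) (at x)"
    by (auto intro!: derivative_eq_intros)
  then have "((\<lambda>x::real. (max 0 x)\<^sup>2) has_field_derivative 2 * x) (at x)"
    by (rule has_field_derivative_transform_within_open[where S = "{0<..}"]) (use greater in auto)
  then show ?thesis using greater by simp
next
  case equal
  have "((\<lambda>h::real. (max 0 h)\<^sup>2 / h) \<longlongrightarrow> 0) (at 0)"
  proof (rule Lim_null_comparison)
    show "\<forall>\<^sub>F h in at 0. norm ((max 0 h)\<^sup>2 / h) \<le> \<bar>h :: real\<bar>"
      by (intro always_eventually allI) (auto simp: max_def power2_eq_square)
    show "((\<lambda>h::real. \<bar>h\<bar>) \<longlongrightarrow> 0) (at 0)" by (rule tendsto_eq_intros refl)+ simp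
  qed
  then show ?thesis using equal by (simp add: DERIV_def)
qed

lemma pos_sq_chain_deriv:
  fixes u :: "real \<Rightarrow> real"
  assumes "(u has_field_derivative D) (at x)"
  shows "((\<lambda>x. (max 0 (u x))\<^sup>2) has_field_derivative 2 * max 0 (u x) * D) (at x)"
  by (rule DERIV_chain2[where f = "\<lambda>x. (max 0 x)\<^sup>2", OF pos_sq_deriv assms])

text \<open>The \<open>C\<^sup>1\<close> spline that rises from \<open>0\<close> at \<open>1/4\<close> to \<open>1\<close> at \<open>3/4\<close>; its derivative is the tent
  function.\<close>

definition smooth_step :: "real \<Rightarrow> real"
  where "smooth_step t = 8 * ((max 0 (t - 1/4))\<^sup>2 - 2 * (max 0 (t - 1/2))\<^sup>2 + (max 0 (t - 3/4))\<^sup>2)"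

definition smooth_step' :: "real \<Rightarrow> real"
  where "smooth_step' t = 16 * (max 0 (t - 1/4) - 2 * max 0 (t - 1/2) + max 0 (t - 3/4))"

lemma smooth_step_deriv: "(smooth_step has_field_derivative smooth_step' t) (at t)"
proof -
  have d: "((\<lambda>t. (max 0 (t - a))\<^sup>2) has_field_derivative 2 * max 0 (t - a)) (at t)" for a :: real
    using pos_sq_chain_deriv[of "\<lambda>t. t - a" 1 t] DERIV_diff[OF DERIV_ident DERIV_const[of a]] by simp
  show ?thesis
    unfolding smooth_step_def [abs_def] smooth_step'_def
    by (rule derivative_eq_intros d refl)+ simp
qed

lemma smooth_step'_bounds: "0 \<le> smooth_step' t" "smooth_step' t \<le> 4"
  by (auto simp: smooth_step'_def max_def)

lemma smooth_step_0: "t \<le> 1/4 \<Longrightarrow> smooth_step t = 0"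
  by (simp add: smooth_step_def max_def)

lemma smooth_step_1: "3/4 \<le> t \<Longrightarrow> smooth_step t = 1"
  by (simp add: smooth_step_def max_def power2_eq_square algebra_simps)

lemma smooth_step_mono: "s \<le> t \<Longrightarrow> smooth_step s \<le> smooth_step t"
  by (rule DERIV_nonneg_imp_nondecreasing) (use smooth_step_deriv smooth_step'_bounds in blast)+

lemma smooth_step_bounds: "0 \<le> smooth_step t" "smooth_step t \<le> 1"
  using smooth_step_mono[of "min t 0" t] smooth_step_mono[of t "max t 1"]
  by (simp_all add: smooth_step_0 smooth_step_1 min_def max_def split: if_splits)

section \<open>The periodic profile and its primitive\<close>

definition neck_arg :: "real \<Rightarrow> real \<Rightarrow> real"
  where "neck_arg e x = (sin (pi * x))\<^sup>2 / e\<^sup>2 - 1"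

text \<open>This is the derivative of the room map in the rescaled variable. It equals 1 where
  \<open>|sin (pi x)| <= e\<close>, that is, around the integers, and is of order \<open>e^4\<close>
  at the half-integers. The square of the positive part makes the transition differentiable.\<close>

definition neck :: "real \<Rightarrow> real \<Rightarrow> real"
  where "neck e x = 1 / (1 + (max 0 (neck_arg e x))\<^sup>2)"

lemma neck_pos: "0 < neck e x"
  by (simp add: neck_def add_pos_nonneg)

lemma neck_le_1: "neck e x \<le> 1"
  by (simp add: neck_def divide_le_eq_1_pos add_pos_nonneg)

lemma neck_eq_1:
  assumes "\<bar>x\<bar> \<le> e / 4" "0 < e"
  shows "neck e x = 1"
proof -
  have "\<bar>sin (pi * x)\<bar> \<le> \<bar>pi * x\<bar>" by (rule abs_sin_x_le_abs_x)
  also have "\<dots> \<le> 4 * (e / 4)" using assms pi_less_4 unfolding abs_mult by (intro mult_mono) auto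
  finally have "(sin (pi * x))\<^sup>2 \<le> e\<^sup>2" using assms(2) by (simp add: abs_le_square_iff[symmetric])
  then show ?thesis using assms(2) by (simp add: neck_def neck_arg_def max_def field_simps)
qed

lemma sin_sq_pi_add_1: "(sin (pi * (x + 1)))\<^sup>2 = (sin (pi * x))\<^sup>2"
  by (simp add: distrib_left)

lemma neck_add_1: "neck e (x + 1) = neck e x"
  by (simp only: neck_def neck_arg_def sin_sq_pi_add_1)

lemma neck_add_of_int: "neck e (x + of_int k) = neck e x"
proof (induction k rule: int_induct[where k = 0])
  case (step1 i)
  then show ?case using neck_add_1[of e "x + of_int i"] by (simp add: add.assoc)
next
  case (step2 i)
  then show ?case using neck_add_1[of e "x + of_int (i - 1)"] by (simp add: add.assoc)
qed simp

lemma neck_reflect: "neck e (1 - x) = neck e x"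
  by (simp add: neck_def neck_arg_def right_diff_distrib)

text \<open>The argument is at most \<open>1 / e^2\<close> because the sine is at most 1, and
  \<open>1 <= 1 / e^4\<close>; so the denominator is at most \<open>2 / e^4\<close>.\<close>

lemma neck_ge:
  assumes "0 < e" "e \<le> 1"
  shows "e ^ 4 / 2 \<le> neck e x"
proof -
  have "max 0 (neck_arg e x) \<le> 1 / e\<^sup>2"
  proof -
    have "(sin (pi * x))\<^sup>2 / e\<^sup>2 \<le> 1 / e\<^sup>2"
      by (intro divide_right_mono) (simp_all add: abs_square_le_1)
    then show ?thesis by (simp add: neck_arg_def)
  qed
  then have "(max 0 (neck_arg e x))\<^sup>2 \<le> (1 / e\<^sup>2)\<^sup>2" by (intro power_mono) auto
  also have "\<dots> = 1 / e ^ 4" by (simp add: power_divide)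
  finally have "1 + (max 0 (neck_arg e x))\<^sup>2 \<le> 1 / e ^ 4 + 1 / e ^ 4"
    using assms by (intro add_mono) (simp_all add: power_le_one)
  also have "\<dots> = 2 / e ^ 4" by simp
  finally have "1 + (max 0 (neck_arg e x))\<^sup>2 \<le> 2 / e ^ 4" .
  then have "1 / (2 / e ^ 4) \<le> 1 / (1 + (max 0 (neck_arg e x))\<^sup>2)"
    using assms by (intro divide_left_mono mult_pos_pos divide_pos_pos) (auto intro: add_pos_nonneg)
  then show ?thesis by (simp add: neck_def)
qed

text \<open>This is the bound on the second derivative that quasiconformality requires, in rescaled
  form. With \<open>p\<close> the positive part of \<open>neck_arg\<close>, the estimate
  \<open>|sin (pi x)| <= e (1 + p)\<close> bounds the derivative of the argument by
  \<open>8 (1 + p) / e\<close>, and \<open>2 p * 8 (1 + p)\<close> is absorbed by the denominator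
  \<open>1 + p^2\<close>.\<close>

lemma neck_deriv:
  assumes "0 < e"
  shows "\<exists>D. (neck e has_field_derivative D) (at x) \<and> e * \<bar>D\<bar> \<le> 32 * neck e x"
proof -
  let ?u = "neck_arg e x"
  let ?p = "max 0 ?u"
  define D1 where "D1 = 2 * sin (pi * x) * cos (pi * x) * pi / e\<^sup>2"
  have u: "(neck_arg e has_field_derivative D1) (at x)"
    unfolding neck_arg_def [abs_def] D1_def
    by (auto intro!: derivative_eq_intros simp: assms[THEN less_imp_neq, symmetric] power2_eq_square divide_simps)
  have "((\<lambda>x. (max 0 (neck_arg e x))\<^sup>2) has_field_derivative 2 * ?p * D1) (at x)"
    by (rule pos_sq_chain_deriv[OF u])
  from DERIV_inverse_fun[OF DERIV_add[OF DERIV_const[of 1] this]]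
  have d: "(neck e has_field_derivative - (2 * ?p * D1) / (1 + ?p\<^sup>2)\<^sup>2) (at x)"
    by (simp add: neck_def [abs_def] divide_inverse power2_eq_square add_nonneg_eq_0_iff mult_ac)
  have "\<bar>D1\<bar> * e \<le> 8 * (1 + ?p)"
  proof -
    have s: "\<bar>sin (pi * x)\<bar> \<le> e * (1 + ?p)"
    proof (rule power2_le_imp_le)
      have "(sin (pi * x))\<^sup>2 = e\<^sup>2 * (1 + ?u)" using assms by (simp add: neck_arg_def)
      also have "\<dots> \<le> e\<^sup>2 * (1 + ?p)\<^sup>2"
        by (intro mult_left_mono order_trans[OF _ self_le_power[of "1 + ?p" 2]]) auto
      finally show "\<bar>sin (pi * x)\<bar>\<^sup>2 \<le> (e * (1 + ?p))\<^sup>2" by (simp add: power_mult_distrib)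
    qed (use assms in auto)
    have "\<bar>D1\<bar> * e = 2 * \<bar>sin (pi * x)\<bar> * \<bar>cos (pi * x)\<bar> * pi / e"
      using assms by (simp add: D1_def abs_mult power2_eq_square)
    also have "\<dots> \<le> 2 * (e * (1 + ?p)) * 1 * 4 / e"
      using assms s pi_less_4 by (intro divide_right_mono mult_mono) auto
    finally show ?thesis using assms by simp
  qed
  then have "e * \<bar>2 * ?p * D1\<bar> \<le> 2 * ?p * (8 * (1 + ?p))"
    using mult_left_mono[of "\<bar>D1\<bar> * e" "8 * (1 + ?p)" "2 * ?p"] by (simp add: abs_mult mult_ac)
  also have "\<dots> \<le> 32 * (1 + ?p\<^sup>2)"
  proof -
    have "0 \<le> (?p - 1)\<^sup>2" by simp
    then show ?thesis by (simp add: power2_eq_square algebra_simps)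
  qed
  finally have b: "e * \<bar>2 * ?p * D1\<bar> \<le> 32 * (1 + ?p\<^sup>2)" .
  have pos: "0 < 1 + ?p\<^sup>2" by (simp add: add_pos_nonneg)
  have "e * \<bar>- (2 * ?p * D1) / (1 + ?p\<^sup>2)\<^sup>2\<bar> = e * \<bar>2 * ?p * D1\<bar> / (1 + ?p\<^sup>2)\<^sup>2"
    by (simp add: abs_divide)
  also have "\<dots> \<le> 32 * (1 + ?p\<^sup>2) / (1 + ?p\<^sup>2)\<^sup>2" by (intro divide_right_mono b) auto
  also have "\<dots> = 32 * neck e x"
  proof -
    have "32 * a / a\<^sup>2 = 32 * (1 / a)" if "0 < a" for a :: real
      using that by (simp add: power2_eq_square)
    from this[OF pos] show ?thesis by (simp only: neck_def)
  qed
  finally show ?thesis using d by blast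
qed

lemma neck_antiderivative_exists:
  assumes "0 < e"
  shows "\<exists>F. F 0 = 0 \<and> (\<forall>x. (F has_field_derivative neck e x) (at x))"
proof -
  have "isCont (neck e) x" for x using neck_deriv[OF assms] DERIV_isCont by blast
  then obtain F where "\<forall>x. (F has_vector_derivative neck e x) (at x)"
    using einterval_antiderivative[of "-\<infinity>" "\<infinity>" "neck e"] by auto
  then have F: "(F has_field_derivative neck e x) (at x)" for x
    by (simp add: has_real_derivative_iff_has_vector_derivative)
  have "((\<lambda>x. F x - F 0) has_field_derivative neck e x) (at x)" for x
    by (rule derivative_eq_intros F refl)+ simp
  then show ?thesis by (intro exI[of _ "\<lambda>x. F x - F 0"]) simp
qed

text \<open>A primitive on the whole line, normalised at 0; negative arguments are covered without
  splitting an integral by sign.\<close>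

definition neck_prim :: "real \<Rightarrow> real \<Rightarrow> real"
  where "neck_prim e = (SOME F. F 0 = 0 \<and> (\<forall>x. (F has_field_derivative neck e x) (at x)))"

context
  fixes e :: real
  assumes e: "0 < e"
begin

lemma neck_prim_0: "neck_prim e 0 = 0"
  and neck_prim_deriv: "(neck_prim e has_field_derivative neck e x) (at x)"
  using someI_ex[OF neck_antiderivative_exists[OF e]] unfolding neck_prim_def by blast+

lemma neck_prim_strict_mono: "x < y \<Longrightarrow> neck_prim e x < neck_prim e y"
  by (rule DERIV_pos_imp_increasing) (use neck_prim_deriv neck_pos in blast)+

text \<open>The profile has period 1, so a shift by an integer changes the primitive only by a
  constant; that constant is additive in the shift.\<close>

lemma neck_prim_add:
  "neck_prim e (of_int k + t) = of_int k * neck_prim e 1 + neck_prim e t"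
proof -
  have shift: "neck_prim e (t + of_int k) = neck_prim e t + neck_prim e (of_int k)" for t k
  proof -
    have "((\<lambda>x. neck_prim e (x + of_int k) - neck_prim e x) has_field_derivative 0) (at x)" for x
      by (rule derivative_eq_intros DERIV_chain2[OF neck_prim_deriv] neck_prim_deriv refl)+
        (simp add: neck_add_of_int)
    from DERIV_isconst_all[OF allI[OF this], of t 0] show ?thesis
      by (simp add: neck_prim_0)
  qed
  have "neck_prim e (of_int k) = of_int k * neck_prim e 1"
  proof (induction k rule: int_induct[where k = 0])
    case base
    show ?case by (simp add: neck_prim_0)
  next
    case (step1 i)
    then show ?case using shift[of "of_int i" 1] by (simp add: algebra_simps)
  next
    case (step2 i)
    then show ?case using shift[of "of_int (i - 1)" 1] by (simp add: algebra_simps)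
  qed
  then show ?thesis using shift[of t k] by (simp add: add.commute)
qed

text \<open>The profile is identically 1 on this interval, so the primitive differs from the
  identity by a constant, which vanishes at 0.\<close>

lemma neck_prim_flat:
  assumes "\<bar>t\<bar> \<le> e / 4"
  shows "neck_prim e t = t"
proof -
  have d: "((\<lambda>x. neck_prim e x - x) has_field_derivative neck e x - 1) (at x)" for x
    by (rule derivative_eq_intros neck_prim_deriv refl)+
  have "\<exists>c. \<forall>x\<in>{-(e/4)..e/4}. neck_prim e x - x = c"
  proof (rule has_field_derivative_zero_constant)
    fix x assume "x \<in> {-(e/4)..e/4}"
    then show "((\<lambda>x. neck_prim e x - x) has_field_derivative 0) (at x within {-(e/4)..e/4})"
      using d[of x] neck_eq_1[of x e] e by (auto intro: has_field_derivative_at_within)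
  qed simp
  then obtain c where "\<forall>x\<in>{-(e/4)..e/4}. neck_prim e x - x = c" by blast
  moreover have "0 \<in> {-(e/4)..e/4}" "t \<in> {-(e/4)..e/4}" using assms e by auto
  ultimately have "neck_prim e 0 - 0 = c" "neck_prim e t - t = c" by blast+
  then show ?thesis by (simp add: neck_prim_0)
qed

lemma neck_prim_1_ge: "e \<le> 1 \<Longrightarrow> e / 4 \<le> neck_prim e 1"
  using neck_prim_flat[of "e / 4"] neck_prim_strict_mono[of "e / 4" 1] e by simp

text \<open>On the half period the profile is dominated by \<open>3 / (1 + (x / e)\<^sup>2)\<close>, whose primitive is
  \<open>3 e arctan (x / e)\<close>.\<close>

lemma neck_prim_1_le: "neck_prim e 1 \<le> 12 * e"
proof -
  \<comment> \<open>The reflection symmetry of the profile makes this sum constant; comparing its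
    values at \<open>1/2\<close> and 0 reduces the estimate to the half period.\<close>
  have "((\<lambda>x. neck_prim e x + neck_prim e (1 - x)) has_field_derivative 0) (at x)" for x
    by (rule derivative_eq_intros DERIV_chain2[OF neck_prim_deriv] neck_prim_deriv refl)+
      (simp add: neck_reflect)
  from DERIV_isconst_all[OF allI[OF this], of "1/2" 0]
  have half: "neck_prim e 1 = 2 * neck_prim e (1/2)" by (simp add: neck_prim_0)
  have dom: "neck e x \<le> 3 / (1 + (x / e)\<^sup>2)" if x: "0 \<le> x" "x \<le> 1/2" for x
  proof -
    let ?u = "neck_arg e x"
    \<comment> \<open>As \<open>pi * x <= 2\<close>, the cubic Taylor bound leaves at least
      \<open>pi * x / 3\<close>, and \<open>pi > 3\<close>.\<close>
    have "x \<le> sin (pi * x)"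
    proof -
      have p: "0 \<le> pi * x" "pi * x \<le> 2"
        using x pi_less_4 mult_mono[of pi 4 x "1/2"] by auto
      have "pi * x - (pi * x) ^ 3 / 6 \<le> sin (pi * x)"
      proof -
        have "\<bar>sin (pi * x) - pi * x\<bar> \<le> (pi * x) ^ 3 / 6"
          using Maclaurin_sin_bound[of "pi * x" 3] p
          by (simp add: sin_coeff_def numeral_3_eq_3 fact_numeral)
        then show ?thesis by linarith
      qed
      moreover have "(pi * x) ^ 3 / 6 \<le> 2 / 3 * (pi * x)"
      proof -
        have "(pi * x)\<^sup>2 * (pi * x) \<le> 2\<^sup>2 * (pi * x)"
          using p by (intro mult_right_mono power_mono) auto
        then show ?thesis unfolding power2_eq_square power3_eq_cube by linarith
      qed
      moreover have "3 * x \<le> pi * x" using x pi_gt3 by (intro mult_right_mono) auto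
      ultimately show ?thesis by linarith
    qed
    then have "(x / e)\<^sup>2 \<le> ?u + 1"
      using e x by (simp add: neck_arg_def power_divide divide_right_mono power_mono)
    also have "\<dots> \<le> max 0 ?u + 1" by simp
    finally have le: "(x / e)\<^sup>2 \<le> max 0 ?u + 1" .
    have "1 + a \<le> 3 * (1 + p\<^sup>2)" if "a \<le> p + 1" for a p :: real
    proof -
      have "2 * p \<le> p\<^sup>2 + 1" using zero_le_power2[of "p - 1"] by (simp add: power2_diff)
      then show ?thesis using that zero_le_power2[of p] by argo
    qed
    from this[OF le] have "1 + (x / e)\<^sup>2 \<le> 3 * (1 + (max 0 ?u)\<^sup>2)" .
    then show ?thesis
      by (simp add: neck_def field_simps add_pos_nonneg)
  qed
  have "neck_prim e (1/2) - 3 * e * arctan ((1/2) / e) \<le> neck_prim e 0 - 3 * e * arctan (0 / e)"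
  proof (rule DERIV_nonpos_imp_nonincreasing[where f = "\<lambda>x. neck_prim e x - 3 * e * arctan (x / e)"])
    fix x :: real assume x: "0 \<le> x" "x \<le> 1/2"
    have "((\<lambda>x. neck_prim e x - 3 * e * arctan (x / e)) has_field_derivative
        neck e x - 3 * e * (inverse (1 + (x / e)\<^sup>2) * (1 / e))) (at x)"
      by (rule derivative_eq_intros neck_prim_deriv refl | use e in simp)+
    moreover have "neck e x - 3 * e * (inverse (1 + (x / e)\<^sup>2) * (1 / e)) \<le> 0"
    proof -
      have "3 * e * (inverse (1 + (x / e)\<^sup>2) * (1 / e)) = 3 / (1 + (x / e)\<^sup>2)"
        using e by (simp add: inverse_eq_divide)
      then show ?thesis using dom[OF x] by linarith
    qed
    ultimately show "\<exists>y. ((\<lambda>x. neck_prim e x - 3 * e * arctan (x / e)) has_field_derivative y) (at x) \<and> y \<le> 0"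
      by blast
  qed simp
  then have "neck_prim e (1/2) \<le> 3 * e * arctan ((1/2) / e)" by (simp add: neck_prim_0)
  \<comment> \<open>The arctangent stays below \<open>pi / 2 < 2\<close>; doubling the half period
    then gives \<open>12 * e\<close>.\<close>
  also have "\<dots> \<le> 3 * e * 2"
    using e arctan_ubound[of "(1/2) / e"] pi_less_4 by (intro mult_left_mono) auto
  finally show ?thesis using half by simp
qed

end

section \<open>The grid domain and its map\<close>

definition mesh :: "nat \<Rightarrow> real" where "mesh j = (1 / 2) ^ j"

text \<open>The factor \<open>1/16\<close> makes \<open>halfwidth j\<close> equal to
  \<open>(mesh (Suc j))^2 / 4\<close>, so that a corridor just fits into the flat part of the
  narrower room below it.\<close>

definition halfwidth :: "nat \<Rightarrow> real" where "halfwidth j = (mesh j)\<^sup>2 / 16"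

lemma mesh_pos [simp]: "0 < mesh j" and mesh_nonneg [simp]: "0 \<le> mesh j" and mesh_nonzero [simp]: "mesh j \<noteq> 0"
  by (simp_all add: mesh_def)

lemma mesh_0: "mesh 0 = 1" by (simp add: mesh_def)

lemma mesh_Suc: "mesh (Suc j) = mesh j / 2" by (simp add: mesh_def)

lemma mesh_le_1: "mesh j \<le> 1" by (simp add: mesh_def power_le_one)

lemma mesh_less: "i < j \<Longrightarrow> mesh j \<le> mesh i / 2"
  using power_decreasing[of "Suc i" j "1/2 :: real"] by (simp add: mesh_def)

lemma two_power_sc: "2 ^ j * mesh j = 1"
  by (simp add: mesh_def power_one_over)

lemma halfwidth_pos [simp]: "0 < halfwidth j" by (simp add: halfwidth_def)

lemma halfwidth_le: "halfwidth j \<le> mesh j / 16"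
  using mult_left_le[of "mesh j" "mesh j"] mesh_le_1 by (simp add: halfwidth_def power2_eq_square)

lemma halfwidth_Suc: "halfwidth (Suc j) = halfwidth j / 4"
  by (simp add: halfwidth_def mesh_Suc power2_eq_square)

definition room :: "nat \<Rightarrow> (real^2) set"
  where "room j = {z. \<bar>z$1\<bar> < 1 \<and> \<bar>z$2 - mesh j\<bar> < halfwidth j}"

text \<open>It runs from the centre line of one room to that of the next, so it overlaps both rooms
  and the union is open and connected.\<close>

definition corridor :: "nat \<Rightarrow> int \<Rightarrow> (real^2) set"
  where "corridor j k = {z. \<bar>z$1 - k * mesh j\<bar> < halfwidth j \<and> mesh (Suc j) < z$2 \<and> z$2 < mesh j}"

definition grid_domain :: "(real^2) set"
  where "grid_domain = (\<Union>j. room j) \<union> (\<Union>j. \<Union>k\<in>{k. \<bar>k\<bar> < 2 ^ j}. corridor j k)"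

lemma grid_domain_cases:
  assumes "z \<in> grid_domain"
  obtains j where "z \<in> room j" | j k where "\<bar>k\<bar> < 2 ^ j" "z \<in> corridor j k"
  using assms unfolding grid_domain_def by auto

lemma open_room: "open (room j)"
  unfolding room_def by (intro open_Collect_conj open_Collect_less continuous_intros)

lemma open_corridor: "open (corridor j k)"
  unfolding corridor_def by (intro open_Collect_conj open_Collect_less continuous_intros)

lemma open_grid_domain: "open grid_domain"
  unfolding grid_domain_def by (intro open_Un open_UN ballI open_room open_corridor)

lemma grid_index_le:
  assumes "\<bar>k :: int\<bar> < 2 ^ j"
  shows "\<bar>k * mesh j\<bar> \<le> 1 - mesh j"
proof -
  have "\<bar>k\<bar> + 1 \<le> 2 ^ j" using assms by linarith
  then have "real_of_int (\<bar>k\<bar> + 1) \<le> real_of_int (2 ^ j)" unfolding of_int_le_iff .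
  then have "real_of_int \<bar>k\<bar> + 1 \<le> 2 ^ j" by simp
  then have "(real_of_int \<bar>k\<bar> + 1) * mesh j \<le> 2 ^ j * mesh j" by (intro mult_right_mono) auto
  then show ?thesis unfolding two_power_sc by (simp add: algebra_simps abs_mult)
qed

lemma grid_domain_bounds:
  assumes "z \<in> grid_domain"
  shows "\<bar>z$1\<bar> < 1" "0 < z$2" "z$2 < 2"
proof -
  have "\<bar>z$1\<bar> < 1 \<and> 0 < z$2 \<and> z$2 < 2" using assms
  proof (cases rule: grid_domain_cases)
    case (1 j)
    then show ?thesis using halfwidth_le[of j] mesh_pos[of j] mesh_le_1[of j] by (auto simp: room_def abs_less_iff)
  next
    case (2 j k)
    then show ?thesis
      using halfwidth_le[of j] mesh_pos[of j] mesh_pos[of "Suc j"] mesh_le_1[of j] grid_index_le[of k j]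
      by (auto simp: corridor_def simp del: mesh_pos)
  qed
  then show "\<bar>z$1\<bar> < 1" "0 < z$2" "z$2 < 2" by auto
qed

text \<open>Different values of \<open>mesh\<close> differ at least by a factor 2, while each band
  reaches only \<open>mesh / 16\<close> away from its centre.\<close>

lemma height_band_unique:
  assumes "\<bar>y - mesh i\<bar> < halfwidth i" "\<bar>y - mesh j\<bar> < halfwidth j"
  shows "i = j"
proof -
  have "\<not> i < j" if "\<bar>y - mesh i\<bar> < halfwidth i" "\<bar>y - mesh j\<bar> < halfwidth j" for i j
    using that mesh_less[of i j] halfwidth_le[of i] halfwidth_le[of j] mesh_pos[of i] by linarith
  then show ?thesis using assms by (meson linorder_neqE_nat)
qed

lemma height_gap_unique:
  assumes "mesh (Suc i) < y" "y < mesh i" "mesh (Suc j) < y" "y < mesh j"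
  shows "i = j"
proof -
  have "\<not> i < j" if "mesh (Suc i) < y" "y < mesh j" for i j
    using that mesh_less[of i j] mesh_Suc[of i] by linarith
  then show ?thesis using assms by (meson linorder_neqE_nat)
qed

lemma grid_index_unique:
  assumes "\<bar>x - k * mesh j\<bar> < halfwidth j" "\<bar>x - k' * mesh j\<bar> < halfwidth j"
  shows "k = (k' :: int)"
proof (rule ccontr)
  assume "k \<noteq> k'"
  then have "1 \<le> \<bar>k - k'\<bar>" by simp
  then have "1 \<le> \<bar>real_of_int k - real_of_int k'\<bar>" by linarith
  then have "mesh j \<le> \<bar>real_of_int k - real_of_int k'\<bar> * mesh j" by simp
  also have "\<dots> = \<bar>k * mesh j - k' * mesh j\<bar>" by (simp add: left_diff_distrib[symmetric] abs_mult)
  finally show False using assms halfwidth_le[of j] mesh_pos[of j] by linarith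
qed

section \<open>Shrinking factors of the rooms and shearing of the corridors\<close>

definition shrink :: "nat \<Rightarrow> real"
  where "shrink j = neck_prim (mesh j) 1"

lemma shrink_bounds: "mesh j / 4 \<le> shrink j" "shrink j \<le> 12 * mesh j"
  unfolding shrink_def by (rule neck_prim_1_ge neck_prim_1_le mesh_pos mesh_le_1)+

text \<open>The primitive conjugated with scaling by \<open>mesh j\<close>; a cell of length
  \<open>mesh j\<close> goes to one of length \<open>mesh j * shrink j\<close>, comparable to the
  square of \<open>mesh j\<close>.\<close>

definition squeeze :: "nat \<Rightarrow> real \<Rightarrow> real"
  where "squeeze j x = mesh j * neck_prim (mesh j) (x / mesh j)"

lemma squeeze_strict_mono: "x < y \<Longrightarrow> squeeze j x < squeeze j y"
  by (simp add: squeeze_def neck_prim_strict_mono divide_strict_right_mono)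

lemma squeeze_deriv: "(squeeze j has_field_derivative neck (mesh j) (x / mesh j)) (at x)"
proof -
  have "((\<lambda>x. neck_prim (mesh j) (x / mesh j)) has_field_derivative neck (mesh j) (x / mesh j) * (1 / mesh j)) (at x)"
    by (rule DERIV_chain2[OF neck_prim_deriv]) (auto intro!: derivative_eq_intros)
  from DERIV_cmult[OF this, of "mesh j"] show ?thesis by (simp add: squeeze_def [abs_def])
qed

text \<open>Near a node the profile is 1, so \<open>squeeze\<close> is a translation there; by
  periodicity it multiplies the position of the node itself by \<open>shrink j\<close>.\<close>

lemma squeeze_near_grid:
  assumes "\<bar>x - of_int k * mesh j\<bar> \<le> (mesh j)\<^sup>2 / 4"
  shows "squeeze j x = x - of_int k * mesh j + shrink j * (of_int k * mesh j)"
    and "neck (mesh j) (x / mesh j) = 1"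
proof -
  define t where "t = x / mesh j - of_int k"
  have x: "x / mesh j = of_int k + t" by (simp add: t_def)
  have "t = (x - of_int k * mesh j) / mesh j" by (simp add: t_def diff_divide_distrib)
  then have "\<bar>t\<bar> = \<bar>x - of_int k * mesh j\<bar> / mesh j" by simp
  also have "\<dots> \<le> ((mesh j)\<^sup>2 / 4) / mesh j" using assms by (intro divide_right_mono) auto
  finally have t: "\<bar>t\<bar> \<le> mesh j / 4" by (simp add: power2_eq_square)
  show "squeeze j x = x - of_int k * mesh j + shrink j * (of_int k * mesh j)"
    unfolding squeeze_def x neck_prim_add[OF mesh_pos] neck_prim_flat[OF mesh_pos t] shrink_def
    by (simp add: t_def algebra_simps)
  show "neck (mesh j) (x / mesh j) = 1"
    unfolding x using neck_add_of_int[of "mesh j" t k] neck_eq_1[OF t] by (simp add: add.commute)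
qed

lemma squeeze_grid: "squeeze j (of_int k * mesh j) = shrink j * (of_int k * mesh j)"
  using squeeze_near_grid(1)[of "of_int k * mesh j" k j] by simp

text \<open>Interpolates between the factors of the two rooms that the corridor joins. The plateaus
  of \<open>smooth_step\<close> over the first and last quarter of the gap make it constant where
  corridor and room overlap.\<close>

definition shear :: "nat \<Rightarrow> real \<Rightarrow> real"
  where "shear j y =
    shrink (Suc j) + (shrink j - shrink (Suc j)) * smooth_step ((y - mesh (Suc j)) / mesh (Suc j))"

lemma shear_top:
  assumes "mesh j - halfwidth j < y"
  shows "shear j y = shrink j"
proof -
  have "3/4 * mesh (Suc j) \<le> y - mesh (Suc j)" using assms halfwidth_le[of j] mesh_Suc[of j] mesh_pos[of j] by linarith
  then have "3/4 \<le> (y - mesh (Suc j)) / mesh (Suc j)" by (simp add: pos_le_divide_eq)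
  then show ?thesis by (simp add: shear_def smooth_step_1)
qed

lemma shear_bottom:
  assumes "y < mesh (Suc j) + halfwidth (Suc j)"
  shows "shear j y = shrink (Suc j)"
proof -
  have "y - mesh (Suc j) \<le> 1/4 * mesh (Suc j)" using assms halfwidth_le[of "Suc j"] mesh_pos[of "Suc j"] by linarith
  then have "(y - mesh (Suc j)) / mesh (Suc j) \<le> 1/4" by (simp add: pos_divide_le_eq)
  then show ?thesis by (simp add: shear_def smooth_step_0)
qed

text \<open>A convex combination of two factors, the smaller lower bound being
  \<open>mesh (Suc j) / 4\<close>.\<close>

lemma shear_ge: "mesh j / 8 \<le> shear j y"
proof -
  let ?s = "smooth_step ((y - mesh (Suc j)) / mesh (Suc j))"
  have "mesh j / 8 = mesh j / 8 * (1 - ?s) + mesh j / 8 * ?s" by (simp add: algebra_simps)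
  also have "\<dots> \<le> shrink (Suc j) * (1 - ?s) + shrink j * ?s"
    using shrink_bounds(1)[of j] shrink_bounds(1)[of "Suc j"] mesh_Suc[of j] mesh_pos[of j]
      smooth_step_bounds[of "(y - mesh (Suc j)) / mesh (Suc j)"]
    by (intro add_mono mult_right_mono) linarith+
  also have "\<dots> = shear j y" by (simp add: shear_def algebra_simps)
  finally show ?thesis .
qed

text \<open>The two factors differ by at most \<open>12 * mesh j\<close>, the step has slope at most
  4, and the gap has length \<open>mesh j / 2\<close>: the scale cancels and leaves
  \<open>12 * 4 * 2\<close>.\<close>

lemma shear_deriv:
  "\<exists>D. (shear j has_field_derivative D) (at y) \<and> \<bar>D\<bar> \<le> 96"
proof -
  define D where "D = (shrink j - shrink (Suc j)) * (smooth_step' ((y - mesh (Suc j)) / mesh (Suc j)) * (1 / mesh (Suc j)))"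
  have "((\<lambda>y. smooth_step ((y - mesh (Suc j)) / mesh (Suc j))) has_field_derivative
      smooth_step' ((y - mesh (Suc j)) / mesh (Suc j)) * (1 / mesh (Suc j))) (at y)"
    by (rule DERIV_chain2[OF smooth_step_deriv]) (auto intro!: derivative_eq_intros)
  from DERIV_add[OF DERIV_const[of "shrink (Suc j)"] DERIV_cmult[OF this, of "shrink j - shrink (Suc j)"]]
  have "(shear j has_field_derivative D) (at y)"
    by (simp add: shear_def [abs_def] D_def)
  moreover have "\<bar>D\<bar> \<le> 12 * mesh j * (4 * (1 / mesh (Suc j)))"
    unfolding D_def abs_mult
  proof (intro mult_mono)
    show "\<bar>shrink j - shrink (Suc j)\<bar> \<le> 12 * mesh j"
      using shrink_bounds[of j] shrink_bounds[of "Suc j"] mesh_Suc[of j] mesh_pos[of j] by linarith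
  qed (use smooth_step'_bounds in auto)
  ultimately show ?thesis by (auto simp: mesh_Suc)
qed

section \<open>The maps on single rooms and corridors\<close>

definition room_map :: "nat \<Rightarrow> real^2 \<Rightarrow> real^2"
  where "room_map j z = vector [squeeze j (z$1), mesh j + neck (mesh j) (z$1 / mesh j) * (z$2 - mesh j)]"

text \<open>Each horizontal slice is translated, with the axis point \<open>k * mesh j\<close> going
  to \<open>shear j y * (k * mesh j)\<close> at height \<open>y\<close>.\<close>

definition corridor_map :: "nat \<Rightarrow> int \<Rightarrow> real^2 \<Rightarrow> real^2"
  where "corridor_map j k z = vector [z$1 - k * mesh j + shear j (z$2) * (k * mesh j), z$2]"

lemma has_derivative_vector2:
  assumes "(u has_derivative u') (at z)" "(v has_derivative v') (at z)"
  shows "((\<lambda>z. vector [u z, v z] :: real^2) has_derivative (\<lambda>d. vector [u' d, v' d])) (at z)"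
  unfolding vector2_eq_axis
  by (intro has_derivative_add has_derivative_scaleR_left assms)

lemma has_derivative_vec_nth: "((\<lambda>z. z $ i) has_derivative (\<lambda>d. d $ i)) (at z)"
  by (rule bounded_linear_imp_has_derivative[OF bounded_linear_vec_nth])

text \<open>Stretching the height by the derivative of \<open>squeeze\<close> makes the diagonal
  entries equal. The off-diagonal entry is the second derivative times a height offset below
  \<open>(mesh j)^2 / 16\<close>, which \<open>neck_deriv\<close> bounds by
  \<open>2 * l\<close>.\<close>

lemma room_map_deriv:
  assumes "z \<in> room j"
  shows "\<exists>l n. (room_map j has_derivative lin2 l 0 n) (at z) \<and> \<bar>n\<bar> \<le> 2 * l \<and> l = neck (mesh j) (z$1 / mesh j)"
proof -
  let ?l = "neck (mesh j) (z$1 / mesh j)"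
  obtain D where D: "(neck (mesh j) has_field_derivative D) (at (z$1 / mesh j))" "mesh j * \<bar>D\<bar> \<le> 32 * ?l"
    using neck_deriv[OF mesh_pos] by blast
  define n where "n = D * (1 / mesh j) * (z$2 - mesh j)"
  have "((\<lambda>x. neck (mesh j) (x / mesh j)) has_field_derivative D * (1 / mesh j)) (at (z$1))"
    by (rule DERIV_chain2[where f = "neck (mesh j)" and g = "\<lambda>x. x / mesh j", OF D(1)]) (auto intro!: derivative_eq_intros)
  note 1 = DERIV_compose_FDERIV[OF this has_derivative_vec_nth]
    and 2 = DERIV_compose_FDERIV[OF squeeze_deriv has_derivative_vec_nth]
  have "(room_map j has_derivative lin2 ?l 0 n) (at z)"
    unfolding room_map_def [abs_def]
    by (rule has_derivative_eq_rhs[OF has_derivative_vector2[OF 2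
          has_derivative_add[OF has_derivative_const has_derivative_mult[OF 1
              has_derivative_diff[OF has_derivative_vec_nth has_derivative_const]]]]])
      (simp add: fun_eq_iff lin2_def n_def mult_ac add_ac)
  moreover have "\<bar>n\<bar> \<le> 2 * ?l"
  proof -
    have "\<bar>n\<bar> \<le> \<bar>D\<bar> * (1 / mesh j) * ((mesh j)\<^sup>2 / 16)"
      unfolding n_def abs_mult using assms by (intro mult_mono) (auto simp: room_def halfwidth_def)
    also have "\<dots> = mesh j * \<bar>D\<bar> / 16" by (simp add: power2_eq_square)
    finally show ?thesis using D(2) by linarith
  qed
  ultimately show ?thesis by blast
qed

lemma corridor_map_deriv:
  assumes "\<bar>k\<bar> < 2 ^ j"
  shows "\<exists>m. (corridor_map j k has_derivative lin2 1 m 0) (at z) \<and> \<bar>m\<bar> \<le> 96"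
proof -
  obtain D where D: "(shear j has_field_derivative D) (at (z$2))" "\<bar>D\<bar> \<le> 96"
    using shear_deriv by blast
  note 1 = DERIV_compose_FDERIV[OF D(1) has_derivative_vec_nth]
  define m where "m = D * (k * mesh j)"
  have "(corridor_map j k has_derivative lin2 1 m 0) (at z)"
    unfolding corridor_map_def [abs_def]
    by (rule has_derivative_eq_rhs[OF has_derivative_vector2[OF
          has_derivative_add[OF has_derivative_diff[OF has_derivative_vec_nth has_derivative_const]
              has_derivative_mult_left[OF 1]] has_derivative_vec_nth]])
      (simp add: fun_eq_iff lin2_def m_def mult_ac)
  moreover have "\<bar>m\<bar> \<le> 96 * 1"
    unfolding m_def abs_mult[of D] using D(2) grid_index_le[OF assms] mesh_pos[of j]
    by (intro mult_mono) linarith+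
  ultimately show ?thesis by auto
qed

text \<open>A corridor meets only the rooms at its two ends. There \<open>shear\<close> equals the
  factor of the room, and the corridor lies in the flat part, where the room map is the same
  translation.\<close>

lemma corridor_room_agree:
  assumes "z \<in> corridor j k" "z \<in> room i"
  shows "corridor_map j k z = room_map i z"
proof -
  have c: "\<bar>z$1 - k * mesh j\<bar> < halfwidth j" "mesh (Suc j) < z$2" "z$2 < mesh j" using assms by (auto simp: corridor_def)
  have r: "\<bar>z$2 - mesh i\<bar> < halfwidth i" using assms by (auto simp: room_def)
  have "i = j \<or> i = Suc j"
  proof -
    have "\<not> i < j" using mesh_less[of i j] c r halfwidth_le[of i] mesh_pos[of i] by linarith
    moreover have "\<not> Suc j < i" using mesh_less[of "Suc j" i] c r halfwidth_le[of i] mesh_pos[of i] by linarith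
    ultimately show ?thesis by linarith
  qed
  then show ?thesis
  proof
    assume [simp]: "i = j"
    have "\<bar>z$1 - k * mesh j\<bar> \<le> (mesh j)\<^sup>2 / 4"
      using c(1) zero_le_power2[of "mesh j"] unfolding halfwidth_def by linarith
    note s = squeeze_near_grid[OF this]
    have "shear j (z$2) = shrink j" using r by (intro shear_top) auto
    then show ?thesis by (simp add: corridor_map_def room_map_def s)
  next
    assume [simp]: "i = Suc j"
    \<comment> \<open>Node \<open>k\<close> of one level is node \<open>2 * k\<close> of the
      next.\<close>
    have *: "k * mesh j = of_int (2 * k) * mesh (Suc j)" by (simp add: mesh_Suc)
    have "halfwidth j = (mesh (Suc j))\<^sup>2 / 4" by (simp add: halfwidth_def mesh_Suc power2_eq_square)
    then have "\<bar>z$1 - of_int (2 * k) * mesh (Suc j)\<bar> \<le> (mesh (Suc j))\<^sup>2 / 4" using c(1) unfolding * by simp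
    note s = squeeze_near_grid[OF this]
    have "shear j (z$2) = shrink (Suc j)" using r by (intro shear_bottom) auto
    then show ?thesis unfolding corridor_map_def room_map_def * by (simp add: s)
  qed
qed

section \<open>Gluing the pieces, injectivity and the derivative bounds\<close>

definition grid_map :: "real^2 \<Rightarrow> real^2"
  where "grid_map z =
    (if \<exists>j. z \<in> room j then room_map (SOME j. z \<in> room j) z
     else let p = SOME p. z \<in> corridor (fst p) (snd p) in corridor_map (fst p) (snd p) z)"

lemma grid_map_room:
  assumes "z \<in> room j"
  shows "grid_map z = room_map j z"
proof -
  have "z \<in> room (SOME j. z \<in> room j)" using assms by (rule someI)
  then have "(SOME j. z \<in> room j) = j" using assms height_band_unique by (auto simp: room_def)
  then show ?thesis using assms by (auto simp: grid_map_def)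
qed

text \<open>In the definition of \<open>grid_map\<close> rooms take precedence; on overlaps the two
  formulas agree, and elsewhere the height and the abscissa determine the corridor.\<close>

lemma grid_map_corridor:
  assumes "z \<in> corridor j k"
  shows "grid_map z = corridor_map j k z"
proof (cases "\<exists>i. z \<in> room i")
  case True
  then show ?thesis using corridor_room_agree[OF assms] grid_map_room by auto
next
  case False
  define p where "p = (SOME p. z \<in> corridor (fst p) (snd p))"
  have p: "z \<in> corridor (fst p) (snd p)"
    unfolding p_def by (rule someI[of _ "(j, k)"]) (simp add: assms)
  then have "fst p = j" using assms height_gap_unique[of "fst p" "z$2" j] by (auto simp: corridor_def)
  moreover from this have "snd p = k"
    using p assms grid_index_unique[of "z$1" "snd p" j k] by (auto simp: corridor_def)
  ultimately show ?thesis using False by (simp add: grid_map_def p_def[symmetric])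
qed

lemma room_map_height: "z \<in> room j \<Longrightarrow> \<bar>room_map j z $ 2 - mesh j\<bar> < halfwidth j"
proof -
  assume z: "z \<in> room j"
  have "\<bar>neck (mesh j) (z$1 / mesh j) * (z$2 - mesh j)\<bar> \<le> 1 * \<bar>z$2 - mesh j\<bar>"
    unfolding abs_mult using neck_le_1 neck_pos[of "mesh j" "z$1 / mesh j"]
    by (intro mult_right_mono) auto
  then show ?thesis using z by (auto simp: room_def room_map_def)
qed

lemma corridor_in_room:
  assumes "\<bar>k\<bar> < 2 ^ j" "z \<in> corridor j k" "\<bar>z$2 - mesh i\<bar> < halfwidth i"
  shows "z \<in> room i"
  using assms grid_domain_bounds(1)[of z] by (auto simp: grid_domain_def room_def)

text \<open>The height of an image point tells whether it comes from a room, and from which one.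
  Inside a room \<open>squeeze\<close> recovers the abscissa and then the positive profile the
  height. Distinct corridors of one level have disjoint images, since their axes stay at least two
  half-widths apart.\<close>

lemma inj_on_grid_map: "inj_on grid_map grid_domain"
proof (rule inj_onI)
  fix z z' assume z: "z \<in> grid_domain" "z' \<in> grid_domain" and eq: "grid_map z = grid_map z'"
  have room_iff: "(\<exists>j. \<bar>grid_map u $ 2 - mesh j\<bar> < halfwidth j) \<longleftrightarrow> (\<exists>j. u \<in> room j)" if "u \<in> grid_domain" for u
    using that
  proof (cases rule: grid_domain_cases)
    case (1 j)
    then show ?thesis using room_map_height grid_map_room by metis
  next
    case (2 j k)
    then have "grid_map u $ 2 = u $ 2" by (simp add: grid_map_corridor corridor_map_def)
    then show ?thesis using corridor_in_room[OF 2] by (auto simp: room_def)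
  qed
  show "z = z'"
  proof (cases "\<exists>j. z \<in> room j")
    case True
    then obtain j j' where j: "z \<in> room j" "z' \<in> room j'" using room_iff z eq by metis
    have "j = j'"
      using room_map_height[OF j(1)] room_map_height[OF j(2)] height_band_unique j eq
      by (auto simp: grid_map_room)
    then have *: "room_map j z = room_map j z'" using j eq by (simp add: grid_map_room)
    then have "squeeze j (z$1) = squeeze j (z'$1)"
      by (simp add: room_map_def vec_eq_iff forall_2)
    then have 1: "z$1 = z'$1" using squeeze_strict_mono[of _ _ j] by (metis less_irrefl linorder_neqE)
    moreover have "z$2 = z'$2"
      using * 1 neck_pos[of "mesh j" "z'$1 / mesh j"] by (simp add: room_map_def vec_eq_iff forall_2)
    ultimately show ?thesis by (simp add: vec_eq_iff forall_2)
  next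
    case False
    moreover have "\<nexists>j. z' \<in> room j" using False room_iff z eq by metis
    ultimately obtain j k j' k' where c: "z \<in> corridor j k" "z' \<in> corridor j' k'"
      using z by (metis grid_domain_cases)
    have eq': "corridor_map j k z = corridor_map j' k' z'" using eq c by (simp add: grid_map_corridor)
    then have 2: "z$2 = z'$2" by (simp add: corridor_map_def vec_eq_iff forall_2)
    then have j: "j' = j" using c height_gap_unique[of j "z$2" j'] by (auto simp: corridor_def)
    have 1: "z$1 - k * mesh j + shear j (z$2) * (k * mesh j) = z'$1 - k' * mesh j + shear j (z$2) * (k' * mesh j)"
      using eq' unfolding j 2[symmetric] by (simp add: corridor_map_def vec_eq_iff forall_2 2)
    have "k = k'"
    proof (rule ccontr)
      assume "k \<noteq> k'"
      then have "1 \<le> \<bar>real_of_int k - real_of_int k'\<bar>" by linarith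
      moreover have sh: "0 \<le> shear j (z$2)" using shear_ge[of j "z$2"] mesh_pos[of j] by linarith
      \<comment> \<open>The left side is exactly \<open>2 * halfwidth j\<close>, which the strict
        corridor inequalities exclude.\<close>
      ultimately have "mesh j / 8 * mesh j * 1 \<le> shear j (z$2) * mesh j * \<bar>real_of_int k - real_of_int k'\<bar>"
        using shear_ge[of j "z$2"] sh by (intro mult_mono) auto
      also have "\<dots> = \<bar>shear j (z$2) * (k * mesh j) - shear j (z$2) * (k' * mesh j)\<bar>"
        using sh
        by (simp add: right_diff_distrib[symmetric] left_diff_distrib[symmetric] abs_mult)
      also have "\<dots> < 2 * halfwidth j"
        using 1 c j by (auto simp: corridor_def)
      finally show False by (simp add: halfwidth_def power2_eq_square)
    qed
    then show ?thesis using 1 2 by (simp add: vec_eq_iff forall_2)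
  qed
qed

text \<open>The lower bound for the scaling factor has to be continuous across rooms of different level,
  hence it is expressed through the height.\<close>

lemma grid_map_deriv:
  assumes "z \<in> grid_domain"
  shows "\<exists>l m n. (grid_map has_derivative lin2 l m n) (at z) \<and> m * n = 0 \<and>
      \<bar>m\<bar> \<le> 96 * l \<and> \<bar>n\<bar> \<le> 96 * l \<and> (z$2 / 2) ^ 4 / 2 \<le> l"
  using assms
proof (cases rule: grid_domain_cases)
  case (1 j)
  obtain l n where d: "(room_map j has_derivative lin2 l 0 n) (at z)" "\<bar>n\<bar> \<le> 2 * l"
    "l = neck (mesh j) (z$1 / mesh j)"
    using room_map_deriv[OF 1] by blast
  have "(grid_map has_derivative lin2 l 0 n) (at z)"
    by (rule has_derivative_transform_within_open[OF d(1) open_room 1]) (simp add: grid_map_room)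
  \<comment> \<open>Heights in the room stay below \<open>2 * mesh j\<close>, so half the height can
    replace \<open>mesh j\<close> in the lower bound for the profile.\<close>
  moreover have "(z$2 / 2) ^ 4 \<le> mesh j ^ 4"
    using 1 halfwidth_le[of j] grid_domain_bounds(2)[OF assms] by (intro power_mono) (auto simp: room_def)
  then have "(z$2 / 2) ^ 4 / 2 \<le> l"
    using neck_ge[of "mesh j" "z$1 / mesh j"] mesh_le_1[of j] unfolding d(3) by simp
  moreover have "0 < l" using neck_pos d(3) by simp
  ultimately show ?thesis using d(2) by (intro exI[of _ l] exI[of _ 0] exI[of _ n]) auto
next
  case (2 j k)
  obtain m where d: "(corridor_map j k has_derivative lin2 1 m 0) (at z)" "\<bar>m\<bar> \<le> 96"
    using corridor_map_deriv[OF 2(1)] by blast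
  have "(grid_map has_derivative lin2 1 m 0) (at z)"
    by (rule has_derivative_transform_within_open[OF d(1) open_corridor 2(2)]) (simp add: grid_map_corridor)
  moreover have "(z$2 / 2) ^ 4 \<le> 1"
    using grid_domain_bounds[OF assms] by (intro power_le_one) auto
  ultimately show ?thesis using d(2) by (intro exI[of _ 1] exI[of _ m] exI[of _ 0]) auto
qed

section \<open>Boundedness of the image and failure of uniform continuity\<close>

lemma bounded_grid_image: "bounded (grid_map ` grid_domain)"
proof -
  have "\<bar>grid_map z $ 1\<bar> \<le> 14 \<and> \<bar>grid_map z $ 2\<bar> \<le> 14" if z: "z \<in> grid_domain" for z
    using z
  proof (cases rule: grid_domain_cases)
    case (1 j)
    \<comment> \<open>The ends 1 and -1 of the room are the nodes of index \<open>2^j\<close> and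
      \<open>-(2^j)\<close>.\<close>
    have sq: "squeeze j (of_int (2 ^ j) * mesh j) = shrink j" "squeeze j (of_int (- (2 ^ j)) * mesh j) = - shrink j"
      unfolding squeeze_grid using two_power_sc[of j] by simp_all
    have "squeeze j (z$1) < squeeze j 1" "squeeze j (-1) < squeeze j (z$1)"
      using grid_domain_bounds(1)[OF z] by (auto intro!: squeeze_strict_mono)
    then have "\<bar>squeeze j (z$1)\<bar> \<le> shrink j" using sq two_power_sc[of j] by simp
    then have "\<bar>grid_map z $ 1\<bar> \<le> 14"
      using shrink_bounds[of j] mesh_le_1[of j] by (simp add: grid_map_room[OF 1] room_map_def)
    moreover have "\<bar>grid_map z $ 2\<bar> \<le> 14"
      using room_map_height[OF 1] halfwidth_le[of j] mesh_le_1[of j] mesh_pos[of j] unfolding grid_map_room[OF 1]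
      by linarith
    ultimately show ?thesis ..
  next
    case (2 j k)
    let ?s = "smooth_step ((z$2 - mesh (Suc j)) / mesh (Suc j))"
    have "shear j (z$2) = shrink (Suc j) * (1 - ?s) + shrink j * ?s"
      by (simp add: shear_def algebra_simps)
    also have "\<dots> \<le> 12 * (1 - ?s) + 12 * ?s"
      using shrink_bounds(2)[of j] shrink_bounds(2)[of "Suc j"] mesh_le_1[of j] mesh_le_1[of "Suc j"]
        smooth_step_bounds[of "(z$2 - mesh (Suc j)) / mesh (Suc j)"]
      by (intro add_mono mult_right_mono) linarith+
    also have "\<dots> = 12" by simp
    finally have "\<bar>shear j (z$2)\<bar> \<le> 12" using shear_ge[of j "z$2"] mesh_pos[of j] by linarith
    then have "\<bar>shear j (z$2) * (k * mesh j)\<bar> \<le> 12 * 1"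
      unfolding abs_mult[of "shear j _"] using grid_index_le[OF 2(1)] mesh_pos[of j]
      by (intro mult_mono) linarith+
    moreover have "\<bar>z$1 - k * mesh j\<bar> < halfwidth j" using 2(2) by (simp add: corridor_def)
    ultimately show ?thesis
      using halfwidth_le[of j] mesh_le_1[of j] grid_domain_bounds[OF z]
      by (simp add: grid_map_corridor[OF 2(2)] corridor_map_def)
  qed
  then have "grid_map z \<in> cbox (vector [-14, -14]) (vector [14, 14])" if "z \<in> grid_domain" for z
    using that by (fastforce simp: mem_box_cart forall_2)
  then show ?thesis by (intro bounded_subset[OF bounded_cbox]) auto
qed

text \<open>The centre line of a room is mapped to itself by \<open>squeeze\<close>, so the straight
  segment between the two image points lies in the image and has length
  \<open>shrink j / 2\<close>.\<close>

lemma grid_image_internal_dist: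
  assumes "1 \<le> j"
  shows "internal_dist (grid_map ` grid_domain) (grid_map (vector [0, mesh j])) (grid_map (vector [1/2, mesh j]))
    \<le> ennreal (6 * mesh j)"
proof -
  let ?p = "\<lambda>x. vector [x, mesh j] :: real^2"
  \<comment> \<open>For positive level the abscissa \<open>1/2\<close> is a node, where
    \<open>squeeze\<close> is known explicitly.\<close>
  obtain i where i: "j = Suc i" using assms by (cases j) auto
  have half: "real_of_int (2 ^ i) * mesh j = 1 / 2"
    using two_power_sc[of i] by (simp add: i mesh_Suc)
  have sq: "squeeze j 0 = 0" "squeeze j (1/2) = shrink j / 2"
    using squeeze_grid[of j 0] squeeze_grid[of j "2 ^ i", unfolded half] by simp_all
  have room: "?p x \<in> room j" if "\<bar>x\<bar> < 1" for x using that by (simp add: room_def)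
  have map: "grid_map (?p x) = ?p (squeeze j x)" if "\<bar>x\<bar> < 1" for x
    by (simp add: grid_map_room[OF room[OF that]] room_map_def)
  let ?g = "linepath (?p 0) (?p (shrink j / 2))"
  have g: "?g t = ?p (t * (shrink j / 2))" for t
    by (simp add: linepath_def vec_eq_iff forall_2 algebra_simps)
  have sh: "0 \<le> shrink j" using shrink_bounds[of j] mesh_pos[of j] by linarith
  have "path_image ?g \<subseteq> grid_map ` grid_domain"
  proof
    fix p assume "p \<in> path_image ?g"
    then obtain t where t: "0 \<le> t" "t \<le> 1" "p = ?p (t * (shrink j / 2))"
      unfolding path_image_def g by auto
    have "\<exists>x\<ge>0. x \<le> 1/2 \<and> squeeze j x = t * (shrink j / 2)"
    proof (rule IVT')
      show "squeeze j 0 \<le> t * (shrink j / 2)" "t * (shrink j / 2) \<le> squeeze j (1/2)"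
        unfolding sq using t sh mult_right_mono[of t 1 "shrink j / 2"] by auto
      show "continuous_on {0..1/2} (squeeze j)"
        by (rule continuous_at_imp_continuous_on) (use squeeze_deriv DERIV_isCont in blast)
    qed simp
    then obtain x where x: "0 \<le> x" "x \<le> 1/2" "squeeze j x = t * (shrink j / 2)" by blast
    then have "\<bar>x\<bar> < 1" by auto
    from map[OF this] have "p = grid_map (?p x)" unfolding x(3) t(3) by (rule sym)
    moreover have "?p x \<in> grid_domain" using room[of x] x by (auto simp: grid_domain_def)
    ultimately show "p \<in> grid_map ` grid_domain" by blast
  qed
  then have "internal_dist (grid_map ` grid_domain) (?p 0) (?p (shrink j / 2)) \<le> curve_length 0 1 ?g"
    unfolding internal_dist_def by (intro INF_lower) simp
  also have "\<dots> \<le> ennreal (shrink j / 2 * (1 - 0))"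
  proof (rule curve_length_lipschitz)
    fix s t :: real assume "s \<le> t"
    have "dist (?g s) (?g t) = \<bar>s * (shrink j / 2) - t * (shrink j / 2)\<bar>"
      unfolding g by (simp add: dist_norm norm_vec_def L2_set_def sum_2)
    also have "\<dots> = t * (shrink j / 2) - s * (shrink j / 2)"
      using mult_right_mono[OF \<open>s \<le> t\<close>, of "shrink j / 2"] sh by simp
    finally show "dist (?g s) (?g t) \<le> shrink j / 2 * (t - s)" by (simp add: algebra_simps)
  qed (use sh in auto)
  also have "\<dots> \<le> ennreal (6 * mesh j)" using shrink_bounds(2)[of j] by (intro ennreal_leI) simp
  finally show ?thesis by (simp add: map sq)
qed

lemma grid_map_inverse_not_uniformly_continuous:
  "\<not> uniformly_continuous_internal (grid_map ` grid_domain) (inv_into grid_domain grid_map)"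
proof
  assume "uniformly_continuous_internal (grid_map ` grid_domain) (inv_into grid_domain grid_map)"
  then obtain d where d: "d > 0" "\<And>x y. x \<in> grid_map ` grid_domain \<Longrightarrow> y \<in> grid_map ` grid_domain \<Longrightarrow>
    internal_dist (grid_map ` grid_domain) x y < ennreal d \<Longrightarrow>
    dist (inv_into grid_domain grid_map x) (inv_into grid_domain grid_map y) < 1/2"
    unfolding uniformly_continuous_internal_def by (metis half_gt_zero zero_less_one)
  obtain i where i: "(1/2) ^ i < d / 6" using real_arch_pow_inv[of "d / 6" "1/2"] d(1) by auto
  define j where "j = Suc i"
  have j: "6 * mesh j < d" using i mesh_Suc[of i] mesh_pos[of i] unfolding j_def mesh_def[of i] by linarith
  have in_dom: "vector [x, mesh j] \<in> grid_domain" if "\<bar>x\<bar> < 1" for x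
  proof -
    have "vector [x, mesh j] \<in> room j" using that by (simp add: room_def)
    then show ?thesis by (auto simp: grid_domain_def)
  qed
  let ?p = "vector [0, mesh j] :: real^2" and ?q = "vector [1/2, mesh j] :: real^2"
  have "internal_dist (grid_map ` grid_domain) (grid_map ?p) (grid_map ?q) \<le> ennreal (6 * mesh j)"
    by (rule grid_image_internal_dist) (simp add: j_def)
  also have "\<dots> < ennreal d" using j d(1) by (intro ennreal_lessI)
  finally have "dist (inv_into grid_domain grid_map (grid_map ?p)) (inv_into grid_domain grid_map (grid_map ?q)) < 1/2"
    by (intro d(2) imageI in_dom) auto
  then have "dist ?p ?q < 1/2"
    by (simp add: inv_into_f_f[OF inj_on_grid_map] in_dom)
  then show False by (simp add: dist_norm norm_vec_def L2_set_def sum_2)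
qed

section \<open>John curves\<close>

text \<open>The curve is parametrised with speed at most \<open>1\<close>; \<open>a\<close> is the length that has already been used up
  before reaching \<open>p\<close>, so that curves can be prolonged at their starting point.\<close>

definition john_reach :: "'a::metric_space set \<Rightarrow> real \<Rightarrow> 'a \<Rightarrow> 'a \<Rightarrow> real \<Rightarrow> bool"
  where "john_reach D C x0 p a \<longleftrightarrow>
    (\<exists>L\<ge>0. \<exists>\<gamma>. \<gamma> 0 = p \<and> \<gamma> L = x0 \<and>
      (\<forall>s t. 0 \<le> s \<longrightarrow> s \<le> t \<longrightarrow> t \<le> L \<longrightarrow> dist (\<gamma> s) (\<gamma> t) \<le> t - s) \<and>
      (\<forall>s. 0 \<le> s \<longrightarrow> s \<le> L \<longrightarrow> \<gamma> s \<in> D \<and> (a + s)\<^sup>2 \<le> C * infdist (\<gamma> s) (frontier D)))"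

lemma john_reach_refl:
  assumes "p \<in> D" "a\<^sup>2 \<le> C * infdist p (frontier D)"
  shows "john_reach D C p p a"
  unfolding john_reach_def using assms by (intro exI[of _ 0] conjI exI[of _ "\<lambda>_. p"]) auto

text \<open>A segment is put in front of the given curve. On the old part the accumulated length is
  at most what was already allowed, because \<open>b + dist p q <= a\<close>; only the new segment
  has to be checked.\<close>

lemma john_reach_segment:
  fixes p q :: "'a::real_normed_vector"
  assumes reach: "john_reach D C x0 q a" and b: "0 \<le> b" "b + dist p q \<le> a"
    and seg: "\<And>u. 0 \<le> u \<Longrightarrow> u \<le> 1 \<Longrightarrow>
      linepath p q u \<in> D \<and> (b + u * dist p q)\<^sup>2 \<le> C * infdist (linepath p q u) (frontier D)"
  shows "john_reach D C x0 p b"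
proof -
  obtain L \<gamma> where L: "0 \<le> L" and \<gamma>: "\<gamma> 0 = q" "\<gamma> L = x0"
    "\<And>s t. 0 \<le> s \<Longrightarrow> s \<le> t \<Longrightarrow> t \<le> L \<Longrightarrow> dist (\<gamma> s) (\<gamma> t) \<le> t - s"
    "\<And>s. 0 \<le> s \<Longrightarrow> s \<le> L \<Longrightarrow> \<gamma> s \<in> D \<and> (a + s)\<^sup>2 \<le> C * infdist (\<gamma> s) (frontier D)"
    using reach unfolding john_reach_def by blast
  define l where "l = dist p q"
  \<comment> \<open>If \<open>p = q\<close>, then \<open>l = 0\<close> and the quotient
    \<open>s / l\<close> is 0 by convention, which still gives the right point.\<close>
  define \<delta> where "\<delta> s = (if s \<le> l then linepath p q (s / l) else \<gamma> (s - l))" for s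
  have l: "0 \<le> l" by (simp add: l_def)
  have \<delta>l: "\<delta> l = q" by (cases "l = 0") (auto simp: \<delta>_def l_def linepath_def)
  have \<delta>2: "\<delta> s = \<gamma> (s - l)" if "l \<le> s" for s
    using that \<delta>l \<gamma>(1) by (cases "s = l") (auto simp: \<delta>_def)
  have lip1: "dist (\<delta> s) (\<delta> t) \<le> t - s" if "0 \<le> s" "s \<le> t" "t \<le> l" for s t
  proof (cases "l = 0")
    case True
    then have "s = t" using that by simp
    then show ?thesis by simp
  next
    case False
    have "\<delta> s - \<delta> t = ((t - s) / l) *\<^sub>R (p - q)"
      using that by (simp add: \<delta>_def linepath_def algebra_simps diff_divide_distrib)
    then have "dist (\<delta> s) (\<delta> t) = (t - s) / l * l"
      using that l by (simp add: dist_norm l_def)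
    then show ?thesis using False by simp
  qed
  have lip2: "dist (\<delta> s) (\<delta> t) \<le> t - s" if "l \<le> s" "s \<le> t" "t \<le> l + L" for s t
    using \<gamma>(3)[of "s - l" "t - l"] \<delta>2[of s] \<delta>2[of t] that by simp
  show ?thesis
    unfolding john_reach_def
  proof (intro exI[of _ "l + L"] conjI exI[of _ \<delta>] allI impI)
    show "0 \<le> l + L" using l L by simp
    show "\<delta> 0 = p" using l by (simp add: \<delta>_def linepath_def)
    show "\<delta> (l + L) = x0" using \<delta>2[of "l + L"] L \<gamma>(2) by simp
    fix s :: real assume s: "0 \<le> s" "s \<le> l + L"
    have "\<delta> s \<in> D \<and> (b + s)\<^sup>2 \<le> C * infdist (\<delta> s) (frontier D)"
    proof (cases "s \<le> l")
      case True
      then have "0 \<le> s / l" "s / l \<le> 1" using s l by (auto simp: divide_le_eq_1)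
      moreover have "s / l * l = s" using True s by auto
      ultimately show ?thesis using seg[of "s / l"] True by (simp add: \<delta>_def l_def[symmetric])
    next
      case False
      then have *: "\<gamma> (s - l) \<in> D" "(a + (s - l))\<^sup>2 \<le> C * infdist (\<gamma> (s - l)) (frontier D)"
        using \<gamma>(4)[of "s - l"] s by auto
      have "(b + s)\<^sup>2 \<le> (a + (s - l))\<^sup>2" using b s by (intro power_mono) (auto simp: l_def)
      then show ?thesis using * \<delta>2[of s] False by auto
    qed
    then show "\<delta> s \<in> D" "(b + s)\<^sup>2 \<le> C * infdist (\<delta> s) (frontier D)" by auto
  next
    fix s t assume st: "0 \<le> s" "s \<le> t" "t \<le> l + L"
    consider "t \<le> l" | "l \<le> s" | "s \<le> l" "l \<le> t" by linarith
    then show "dist (\<delta> s) (\<delta> t) \<le> t - s"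
    proof cases
      case 3
      have "dist (\<delta> s) (\<delta> t) \<le> dist (\<delta> s) (\<delta> l) + dist (\<delta> l) (\<delta> t)" by (rule dist_triangle)
      then show ?thesis using lip1[of s l] lip2[of l t] 3 st by linarith
    qed (use st lip1 lip2 in auto)
  qed
qed

text \<open>Rescaling to the unit interval, the speed bound gives length at most
  \<open>L * t\<close> up to time \<open>t\<close>. Connectedness of the domain comes from the same
  curves.\<close>

lemma John_domain_of_reach:
  fixes D :: "'a::euclidean_space set"
  assumes "open D" "bounded D" "x0 \<in> D"
    and reach: "\<And>x. x \<in> D \<Longrightarrow> john_reach D C x0 x 0"
  shows "John_domain 2 D"
proof -
  have curve: "\<exists>g. path g \<and> path_image g \<subseteq> D \<and> pathstart g = x \<and> pathfinish g = x0 \<and> rectifiable g \<and>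
       (\<forall>t. 0 < t \<and> t \<le> 1 \<longrightarrow>
          C * infdist (g t) (frontier D) \<ge> enn2real (curve_length 0 t g) powr 2)" if x: "x \<in> D" for x
  proof -
    obtain L \<gamma> where L: "0 \<le> L" and \<gamma>: "\<gamma> 0 = x" "\<gamma> L = x0"
      "\<And>s t. 0 \<le> s \<Longrightarrow> s \<le> t \<Longrightarrow> t \<le> L \<Longrightarrow> dist (\<gamma> s) (\<gamma> t) \<le> t - s"
      "\<And>s. 0 \<le> s \<Longrightarrow> s \<le> L \<Longrightarrow> \<gamma> s \<in> D \<and> (0 + s)\<^sup>2 \<le> C * infdist (\<gamma> s) (frontier D)"
      using reach[OF x] unfolding john_reach_def by blast
    define g where "g t = \<gamma> (L * t)" for t
    have in_L: "0 \<le> L * t" "L * t \<le> L" if "0 \<le> t" "t \<le> 1" for t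
      using that L by (auto simp: mult_left_le)
    have lip: "dist (g s) (g t) \<le> L * (t - s)" if "0 \<le> s" "s \<le> t" "t \<le> 1" for s t
      using \<gamma>(3)[of "L * s" "L * t"] that L in_L[of s] in_L[of t]
      by (simp add: g_def mult_left_mono right_diff_distrib)
    have "L-lipschitz_on {0..1} g"
      using lip L by (intro lipschitz_on_leI) (auto simp: dist_real_def)
    then have "path g" unfolding path_def by (rule lipschitz_on_continuous_on)
    have len: "curve_length 0 t g \<le> ennreal (L * t)" if "0 \<le> t" "t \<le> 1" for t
      using curve_length_lipschitz[of 0 t L g] lip that L by auto
    have "rectifiable g" unfolding rectifiable_def
      using le_less_trans[OF len[of 1], of \<infinity>] by simp
    moreover have "enn2real (curve_length 0 t g) powr 2 \<le> C * infdist (g t) (frontier D)"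
      if "0 < t" "t \<le> 1" for t
    proof -
      have "enn2real (curve_length 0 t g) \<le> L * t"
        using enn2real_mono[OF len[of t]] that L by auto
      then have "enn2real (curve_length 0 t g) powr 2 \<le> (0 + L * t)\<^sup>2"
        by (simp add: power_mono)
      also have "\<dots> \<le> C * infdist (g t) (frontier D)"
        using \<gamma>(4)[of "L * t"] in_L[of t] that by (simp add: g_def)
      finally show ?thesis .
    qed
    moreover have "path_image g \<subseteq> D" using \<gamma>(4) in_L by (auto simp: path_image_def g_def)
    ultimately show ?thesis using \<gamma>(1,2) \<open>path g\<close>
      by (intro exI[of _ g]) (auto simp: pathstart_def pathfinish_def g_def)
  qed
  have "path_component D x x0" if "x \<in> D" for x
    using curve[OF that] unfolding path_component_def by blast
  then have "path_connected D"
    unfolding path_connected_component by (meson path_component_sym path_component_trans)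
  then have "is_domain D" using assms by (auto simp: is_domain_def path_connected_imp_connected)
  then show ?thesis unfolding John_domain_def using assms(2,3) curve by auto
qed

lemma infdist_frontier_ge:
  fixes D :: "'a::euclidean_space set"
  assumes "open D" "bounded D" "ball z r \<subseteq> D" "0 < r"
  shows "r \<le> infdist z (frontier D)"
proof -
  \<comment> \<open>The frontier must be nonempty, since \<open>infdist\<close> to the empty set is
    0 by convention.\<close>
  have "D \<noteq> {}" using assms(3,4) by auto
  moreover have "D \<noteq> UNIV" using assms(2) not_bounded_UNIV by blast
  ultimately have ne: "frontier D \<noteq> {}" by (simp add: frontier_eq_empty)
  have "r \<le> dist z a" if "a \<in> frontier D" for a
    using that assms(1,3) by (force simp: frontier_def interior_open)
  then show ?thesis using ne by (simp add: infdist_notempty cINF_greatest)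
qed

text \<open>Along the segment from \<open>z\<close> to the centre \<open>c\<close>, convexity
  provides a cone: at parameter \<open>u\<close> a ball of radius \<open>u * r\<close> fits. The
  squared length \<open>u^2 * (dist z c)^2\<close> is at most \<open>u * C * r\<close> since
  \<open>u <= 1\<close>.\<close>

lemma john_reach_convex:
  fixes D :: "'a::euclidean_space set"
  assumes D: "open D" "bounded D" and U: "convex U" "U \<subseteq> D" "z \<in> U" "ball c r \<subseteq> U" and r: "0 < r"
    and C: "0 \<le> C" "(dist z c)\<^sup>2 \<le> C * r"
    and reach: "john_reach D C x0 c a" "dist z c \<le> a"
  shows "john_reach D C x0 z 0"
proof (rule john_reach_segment[OF reach(1)])
  fix u :: real assume u: "0 \<le> u" "u \<le> 1"
  have "c \<in> U" using U(4) r by auto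
  then have inU: "linepath z c u \<in> U"
    using U(1,3) u by (simp add: linepath_def convexD)
  have "(0 + u * dist z c)\<^sup>2 \<le> C * infdist (linepath z c u) (frontier D)"
  proof (cases "u = 0")
    case True
    then show ?thesis using C(1) by (simp add: infdist_nonneg)
  next
    case False
    have "ball (linepath z c u) (u * r) \<subseteq> U"
    proof
      fix p assume p: "p \<in> ball (linepath z c u) (u * r)"
      \<comment> \<open>The preimage of \<open>p\<close> under the homothety with centre
        \<open>z\<close> and ratio \<open>u\<close>.\<close>
      define d where "d = c + (1 / u) *\<^sub>R (p - linepath z c u)"
      have "dist c d = dist (linepath z c u) p / u"
        using u by (simp add: d_def dist_norm norm_minus_commute)
      also have "\<dots> < r" using p u False by (simp add: field_simps)
      finally have "d \<in> U" using U(4) by auto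
      moreover have "p = (1 - u) *\<^sub>R z + u *\<^sub>R d"
        using False by (simp add: d_def linepath_def algebra_simps)
      ultimately show "p \<in> U" using convexD[OF U(1,3), of d "1 - u" u] u by simp
    qed
    then have "u * r \<le> infdist (linepath z c u) (frontier D)"
      using U(2) u False r by (intro infdist_frontier_ge D) auto
    then have "C * (u * r) \<le> C * infdist (linepath z c u) (frontier D)"
      using C(1) by (intro mult_left_mono)
    moreover have "(u * dist z c)\<^sup>2 \<le> u * (C * r)"
    proof -
      have "u\<^sup>2 * (dist z c)\<^sup>2 \<le> u * (C * r)"
        using u C(2) by (intro mult_mono) (auto simp: power2_eq_square mult_left_le)
      then show ?thesis by (simp add: power_mult_distrib)
    qed
    ultimately show ?thesis by (simp add: mult_ac)
  qed
  then show "linepath z c u \<in> D \<and> (0 + u * dist z c)\<^sup>2 \<le> C * infdist (linepath z c u) (frontier D)"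
    using inU U(2) by auto
qed (use reach in auto)

section \<open>The John property of the grid\<close>

lemma bounded_grid_domain: "bounded grid_domain"
proof -
  have "z \<in> cbox (vector [-1, 0]) (vector [1, 2])" if "z \<in> grid_domain" for z
    using grid_domain_bounds[OF that] by (auto simp: mem_box_cart forall_2)
  then show ?thesis by (intro bounded_subset[OF bounded_cbox]) auto
qed

lemma grid_infdist_ge:
  assumes "ball z r \<subseteq> grid_domain" "0 < r"
  shows "r \<le> infdist z (frontier grid_domain)"
  by (rule infdist_frontier_ge[OF open_grid_domain bounded_grid_domain assms])

lemma convex_room: "convex (room j)"
proof -
  have "room j = box (vector [-1, mesh j - halfwidth j]) (vector [1, mesh j + halfwidth j])"
    by (auto simp: room_def mem_box_cart forall_2)
  then show ?thesis by simp
qed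

lemma convex_corridor: "convex (corridor j k)"
proof -
  have "corridor j k = box (vector [k * mesh j - halfwidth j, mesh (Suc j)]) (vector [k * mesh j + halfwidth j, mesh j])"
    by (auto simp: corridor_def mem_box_cart forall_2)
  then show ?thesis by simp
qed

lemma mem_ball_component:
  fixes z z' :: "real^'n"
  shows "z' \<in> ball z r \<Longrightarrow> \<bar>z' $ i - z $ i\<bar> < r"
  using component_le_norm_cart[of "z' - z" i] by (simp add: dist_norm norm_minus_commute)

lemma ball_in_room:
  assumes "\<bar>x\<bar> + halfwidth j \<le> 1"
  shows "ball (vector [x, mesh j]) (halfwidth j) \<subseteq> room j"
proof
  fix z :: "real^2" assume z: "z \<in> ball (vector [x, mesh j]) (halfwidth j)"
  show "z \<in> room j"
    using mem_ball_component[OF z, of 1] mem_ball_component[OF z, of 2] assms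
    by (auto simp: room_def)
qed

text \<open>Near the ends of the column the ball spills over into the rooms; its radius is the
  smaller of the two half-widths, so it fits into each piece.\<close>

lemma ball_in_column:
  fixes k :: int
  assumes k: "\<bar>k\<bar> < 2 ^ j" and y: "mesh (Suc j) \<le> y" "y \<le> mesh j"
  shows "ball (vector [k * mesh j, y]) (halfwidth (Suc j)) \<subseteq> grid_domain"
proof
  fix z :: "real^2" assume z: "z \<in> ball (vector [k * mesh j, y]) (halfwidth (Suc j))"
  have c: "\<bar>z$1 - k * mesh j\<bar> < halfwidth (Suc j)" "\<bar>z$2 - y\<bar> < halfwidth (Suc j)"
    using mem_ball_component[OF z, of 1] mem_ball_component[OF z, of 2] by auto
  have w: "halfwidth (Suc j) \<le> halfwidth j" using halfwidth_Suc[of j] halfwidth_pos[of j] by linarith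
  have x: "\<bar>z$1\<bar> < 1" using c(1) grid_index_le[OF k] halfwidth_le[of j] w mesh_pos[of j] by linarith
  consider "z$2 \<le> mesh (Suc j)" | "mesh j \<le> z$2" | "mesh (Suc j) < z$2" "z$2 < mesh j" by linarith
  then show "z \<in> grid_domain"
  proof cases
    case 1
    then have "z \<in> room (Suc j)" using x c(2) y by (auto simp: room_def)
    then show ?thesis by (auto simp: grid_domain_def)
  next
    case 2
    then have "z \<in> room j" using x c(2) y w by (auto simp: room_def)
    then show ?thesis by (auto simp: grid_domain_def)
  next
    case 3
    then have "z \<in> corridor j k" using c(1) w by (auto simp: corridor_def)
    then show ?thesis using k by (auto simp: grid_domain_def)
  qed
qed

lemma linepath_vector2:
  "linepath (vector [a, b] :: real^2) (vector [c, d]) u = vector [linepath a c u, linepath b d u]"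
  by (simp add: linepath_def vec_eq_iff forall_2)

lemma dist_vector2_le: "dist (vector [a, b] :: real^2) (vector [c, d]) \<le> \<bar>a - c\<bar> + \<bar>b - d\<bar>"
  using norm_le_l1_cart[of "vector [a, b] - vector [c, d] :: real^2"] by (simp add: dist_norm sum_2)

lemma linepath_real_bounds:
  fixes a b :: real
  assumes "0 \<le> u" "u \<le> 1" "l \<le> a" "l \<le> b" "a \<le> m" "b \<le> m"
  shows "l \<le> linepath a b u" "linepath a b u \<le> m"
proof -
  have "linepath a b u \<in> {l..m}"
    using assms convexD[of "{l..m}" a b "1 - u" u] by (simp add: linepath_def)
  then show "l \<le> linepath a b u" "linepath a b u \<le> m" by auto
qed

text \<open>The constant satisfies \<open>256 * halfwidth j = (4 * mesh j)^2\<close>: at distance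
  \<open>halfwidth j\<close> from the boundary, length up to \<open>4 * mesh j\<close> is
  allowed.\<close>

abbreviation "grid_reach \<equiv> john_reach grid_domain 256 (vector [0, 1])"

text \<open>During the climb the used length stays within \<open>2 * mesh j\<close>, and its square
  is exactly \<open>256 * halfwidth (Suc j)\<close>.\<close>

lemma grid_reach_column:
  fixes k :: int
  assumes top: "grid_reach (vector [k * mesh j, mesh j]) (2 * mesh j)"
    and k: "\<bar>k\<bar> < 2 ^ j" and y: "mesh (Suc j) \<le> y" "y \<le> mesh j"
    and b: "0 \<le> b" "b + (mesh j - y) \<le> 2 * mesh j"
  shows "grid_reach (vector [k * mesh j, y]) b"
proof (rule john_reach_segment[OF top])
  let ?d = "dist (vector [k * mesh j, y] :: real^2) (vector [k * mesh j, mesh j])"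
  have d: "?d \<le> mesh j - y" using dist_vector2_le[of "k * mesh j" y "k * mesh j" "mesh j"] y by simp
  then show "b + ?d \<le> 2 * mesh j" using b by simp
  fix u :: real assume u: "0 \<le> u" "u \<le> 1"
  have ball: "ball (linepath (vector [k * mesh j, y]) (vector [k * mesh j, mesh j]) u) (halfwidth (Suc j)) \<subseteq> grid_domain"
    unfolding linepath_vector2 linepath_refl
    by (rule ball_in_column[OF k]) (use linepath_real_bounds[OF u] y in auto)
  have "u * ?d \<le> 1 * ?d" using u by (intro mult_right_mono) auto
  then have "(b + u * ?d)\<^sup>2 \<le> (2 * mesh j)\<^sup>2"
    using b d u by (intro power_mono) auto
  also have "\<dots> = 256 * halfwidth (Suc j)" by (simp add: halfwidth_def mesh_Suc power2_eq_square)
  also have "\<dots> \<le> 256 * infdist (linepath (vector [k * mesh j, y]) (vector [k * mesh j, mesh j]) u) (frontier grid_domain)"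
    by (intro mult_left_mono grid_infdist_ge ball) auto
  finally show "linepath (vector [k * mesh j, y]) (vector [k * mesh j, mesh j]) u \<in> grid_domain \<and>
      (b + u * ?d)\<^sup>2 \<le> 256 * infdist (linepath (vector [k * mesh j, y]) (vector [k * mesh j, mesh j]) u) (frontier grid_domain)"
    using subsetD[OF ball] by simp
qed (rule b)

text \<open>Induction on the level. With \<open>h\<close> the mesh of the lower level, a used length
  \<open>2 * h\<close> grows to at most \<open>3 * h\<close> on the way to the nearest corridor
  upwards and to \<open>4 * h\<close> during the climb, which is twice the mesh of the upper level:
  the invariant reproduces itself.\<close>

lemma grid_reach_node:
  fixes k :: int
  assumes "\<bar>k\<bar> < 2 ^ j"
  shows "grid_reach (vector [k * mesh j, mesh j]) (2 * mesh j)"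
  using assms
proof (induction j arbitrary: k)
  case 0
  then have k: "k = 0" by simp
  have b: "ball (vector [0, 1]) (halfwidth 0) \<subseteq> room 0"
    using ball_in_room[of 0 0] by (simp add: mesh_0 halfwidth_def)
  then have b': "ball (vector [0, 1]) (halfwidth 0) \<subseteq> grid_domain" by (auto simp: grid_domain_def)
  have "(2 * mesh 0)\<^sup>2 \<le> 256 * halfwidth 0" by (simp add: mesh_0 halfwidth_def)
  also have "\<dots> \<le> 256 * infdist (vector [0, 1]) (frontier grid_domain)"
    by (intro mult_left_mono grid_infdist_ge b') auto
  finally have "(2 * mesh 0)\<^sup>2 \<le> 256 * infdist (vector [0, 1]) (frontier grid_domain)" .
  then show ?case using subsetD[OF b', of "vector [0, 1]"] by (simp add: k mesh_0 john_reach_refl)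
next
  case (Suc j)
  let ?h = "mesh (Suc j)"
  \<comment> \<open>Half of \<open>k\<close>, rounded towards zero, so that the bound
    \<open>2^j\<close> on the index survives for negative \<open>k\<close> too.\<close>
  define k' where "k' = sgn k * (\<bar>k\<bar> div 2)"
  have k': "\<bar>k'\<bar> < 2 ^ j" "\<bar>k - 2 * k'\<bar> \<le> 1"
    using Suc.prems unfolding k'_def by (cases k "0 :: int" rule: linorder_cases; auto simp: abs_mult)+
  have eq: "k' * mesh j = of_int (2 * k') * ?h" by (simp add: mesh_Suc)
  have "grid_reach (vector [k' * mesh j, ?h]) (3 * ?h)"
    by (rule grid_reach_column[OF Suc.IH[OF k'(1)] k'(1)]) (use mesh_Suc[of j] mesh_pos[of j] in linarith)+
  then show ?case
  proof (rule john_reach_segment)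
    let ?p = "vector [k * ?h, ?h] :: real^2" and ?q = "vector [k' * mesh j, ?h] :: real^2"
    have "real_of_int \<bar>k - 2 * k'\<bar> * ?h \<le> 1 * ?h"
      using k'(2) by (intro mult_right_mono) (auto simp flip: of_int_abs)
    then have diff: "\<bar>k * ?h - k' * mesh j\<bar> \<le> ?h"
      unfolding eq by (simp add: left_diff_distrib[symmetric] abs_mult)
    have d: "dist ?p ?q \<le> ?h"
      using dist_vector2_le[of "k * ?h" ?h "k' * mesh j" ?h] diff by simp
    then show "2 * ?h + dist ?p ?q \<le> 3 * ?h" by simp
    fix u :: real assume u: "0 \<le> u" "u \<le> 1"
    have "\<bar>k * ?h\<bar> \<le> 1 - ?h" "\<bar>k' * mesh j\<bar> \<le> 1 - ?h"
      using grid_index_le[OF Suc.prems] grid_index_le[OF k'(1)] mesh_Suc[of j] mesh_pos[of j] by linarith+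
    then have "\<bar>linepath (k * ?h) (k' * mesh j) u\<bar> \<le> 1 - ?h"
      using linepath_real_bounds[OF u, of "-(1 - ?h)" "k * ?h" "k' * mesh j" "1 - ?h"] by linarith
    then have "ball (linepath ?p ?q u) (halfwidth (Suc j)) \<subseteq> room (Suc j)"
      unfolding linepath_vector2 linepath_refl
      using halfwidth_le[of "Suc j"] mesh_pos[of "Suc j"] by (intro ball_in_room) linarith
    then have ball: "ball (linepath ?p ?q u) (halfwidth (Suc j)) \<subseteq> grid_domain" by (auto simp: grid_domain_def)
    have "u * dist ?p ?q \<le> 1 * dist ?p ?q" using u by (intro mult_right_mono) auto
    moreover have "0 \<le> u * dist ?p ?q" using u by simp
    ultimately have "(2 * ?h + u * dist ?p ?q)\<^sup>2 \<le> (4 * ?h)\<^sup>2"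
      using d mesh_pos[of "Suc j"] by (intro power_mono) linarith+
    also have "\<dots> = 256 * halfwidth (Suc j)" by (simp add: halfwidth_def power2_eq_square)
    also have "\<dots> \<le> 256 * infdist (linepath ?p ?q u) (frontier grid_domain)"
      by (intro mult_left_mono grid_infdist_ge ball) auto
    finally show "linepath ?p ?q u \<in> grid_domain \<and>
        (2 * ?h + u * dist ?p ?q)\<^sup>2 \<le> 256 * infdist (linepath ?p ?q u) (frontier grid_domain)"
      using subsetD[OF ball] by simp
  qed simp
qed

text \<open>Rounding \<open>x * 2^j\<close> towards zero keeps the index strictly between
  \<open>-(2^j)\<close> and \<open>2^j\<close>.\<close>

lemma grid_index_near:
  assumes "\<bar>x\<bar> < 1"
  shows "\<exists>k. \<bar>k\<bar> < (2 ^ j :: int) \<and> \<bar>x - k * mesh j\<bar> \<le> mesh j"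
proof -
  have nonneg: "\<exists>k. 0 \<le> k \<and> k < (2 ^ j :: int) \<and> \<bar>x - k * mesh j\<bar> \<le> mesh j" if x: "0 \<le> x" "x < 1" for x
  proof (intro exI conjI)
    let ?k = "\<lfloor>x * 2 ^ j\<rfloor>"
    show "0 \<le> ?k" using x by simp
    show "?k < 2 ^ j" using x by (simp add: floor_less_iff)
    have "x - ?k * mesh j = (x * 2 ^ j - ?k) * mesh j"
      using two_power_sc[of j] by (simp add: algebra_simps)
    moreover have "0 \<le> x * 2 ^ j - ?k" "x * 2 ^ j - ?k \<le> 1" by linarith+
    ultimately show "\<bar>x - ?k * mesh j\<bar> \<le> mesh j"
      by (simp add: abs_mult mult_left_le_one_le)
  qed
  show ?thesis
  proof (cases "0 \<le> x")
    case True
    then obtain k :: int where "0 \<le> k" "k < 2 ^ j" "\<bar>x - k * mesh j\<bar> \<le> mesh j"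
      using nonneg[of x] assms by auto
    then show ?thesis by (intro exI[of _ k]) auto
  next
    case False
    then obtain k :: int where "0 \<le> k" "k < 2 ^ j" "\<bar>- x - k * mesh j\<bar> \<le> mesh j"
      using nonneg[of "- x"] assms by auto
    then show ?thesis by (intro exI[of _ "- k"]) auto
  qed
qed

text \<open>A point of a room is first joined to a nearby node, a point of a corridor to the
  midpoint of that corridor; both pieces are convex, and from there the curves through the grid take
  over.\<close>

lemma John_grid_domain: "John_domain 2 grid_domain"
proof (rule John_domain_of_reach[OF open_grid_domain bounded_grid_domain])
  have "vector [0, 1] \<in> room 0" by (simp add: room_def mesh_0)
  then show "vector [0, 1] \<in> grid_domain" by (auto simp: grid_domain_def)
  fix z :: "real^2" assume "z \<in> grid_domain"
  then show "grid_reach z 0"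
  proof (cases rule: grid_domain_cases)
    case (1 j)
    obtain k :: int where k: "\<bar>k\<bar> < 2 ^ j" "\<bar>z$1 - k * mesh j\<bar> \<le> mesh j"
      using grid_index_near[of "z$1" j] 1 by (auto simp: room_def)
    let ?c = "vector [k * mesh j, mesh j] :: real^2"
    have "z = vector [z$1, z$2]" by (simp add: vec_eq_iff forall_2)
    then have "dist z ?c \<le> \<bar>z$1 - k * mesh j\<bar> + \<bar>z$2 - mesh j\<bar>" by (metis dist_vector2_le)
    then have d: "dist z ?c \<le> 2 * mesh j"
      using k(2) 1 halfwidth_le[of j] mesh_pos[of j] by (auto simp: room_def simp del: mesh_pos)
    show ?thesis
    proof (rule john_reach_convex[OF open_grid_domain bounded_grid_domain convex_room _ 1])
      show "room j \<subseteq> grid_domain" by (auto simp: grid_domain_def)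
      show "ball ?c (halfwidth j) \<subseteq> room j"
        using grid_index_le[OF k(1)] halfwidth_le[of j] mesh_pos[of j] by (intro ball_in_room) linarith
      have "(dist z ?c)\<^sup>2 \<le> (2 * mesh j)\<^sup>2" using d by (intro power_mono) auto
      also have "\<dots> \<le> 256 * halfwidth j" by (simp add: halfwidth_def power_mult_distrib)
      finally show "(dist z ?c)\<^sup>2 \<le> 256 * halfwidth j" .
    qed (use grid_reach_node[OF k(1)] d in auto)
  next
    case (2 j k)
    let ?c = "vector [k * mesh j, 3 / 4 * mesh j] :: real^2"
    have z: "\<bar>z$1 - k * mesh j\<bar> < halfwidth j" "mesh (Suc j) < z$2" "z$2 < mesh j" using 2 by (auto simp: corridor_def)
    have "z = vector [z$1, z$2]" by (simp add: vec_eq_iff forall_2)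
    then have "dist z ?c \<le> \<bar>z$1 - k * mesh j\<bar> + \<bar>z$2 - 3 / 4 * mesh j\<bar>" by (metis dist_vector2_le)
    then have d: "dist z ?c \<le> mesh j"
      using z halfwidth_le[of j] mesh_Suc[of j] by linarith
    have reach: "grid_reach ?c (mesh j)"
      by (rule grid_reach_column[OF grid_reach_node[OF 2(1)] 2(1)]) (use mesh_Suc[of j] mesh_pos[of j] in linarith)+
    show ?thesis
    proof (rule john_reach_convex[OF open_grid_domain bounded_grid_domain convex_corridor _ 2(2)])
      show "corridor j k \<subseteq> grid_domain" using 2(1) by (auto simp: grid_domain_def)
      show "ball ?c (halfwidth j) \<subseteq> corridor j k"
      proof
        fix p assume p: "p \<in> ball ?c (halfwidth j)"
        show "p \<in> corridor j k"
          using mem_ball_component[OF p, of 1] mem_ball_component[OF p, of 2] halfwidth_le[of j] mesh_Suc[of j] mesh_pos[of j]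
          by (auto simp: corridor_def abs_less_iff simp del: mesh_pos)
      qed
      have "(dist z ?c)\<^sup>2 \<le> (mesh j)\<^sup>2" using d by (intro power_mono) auto
      also have "\<dots> \<le> 256 * halfwidth j" by (simp add: halfwidth_def)
      finally show "(dist z ?c)\<^sup>2 \<le> 256 * halfwidth j" .
    qed (use reach d in auto)
  qed
qed

theorem theorem1p2:
  shows "\<exists>(\<Omega>' :: (real^2) set) (\<Omega> :: (real^2) set) (f :: real^2 \<Rightarrow> real^2).
           is_domain \<Omega>' \<and> bounded \<Omega>' \<and>
           John_domain 2 \<Omega> \<and>
           quasiconformal \<Omega>' \<Omega> f \<and>
           \<not> uniformly_continuous_internal \<Omega>' f"
proof -
  have dom: "is_domain grid_domain" using John_grid_domain by (simp add: John_domain_def)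
  have c: "continuous_on grid_domain (\<lambda>z. (z$2 / 2) ^ 4 / 2)" by (intro continuous_intros) auto
  have pos: "0 < (z$2 / 2) ^ 4 / 2" if "z \<in> grid_domain" for z :: "real^2"
    using grid_domain_bounds(2)[OF that] by simp
  \<comment> \<open>The map sought is the inverse of \<open>grid_map\<close>, from the image onto
    the grid.\<close>
  note qc = quasiconformal_inverse[OF dom inj_on_grid_map c pos grid_map_deriv]
  show ?thesis
    using qc John_grid_domain bounded_grid_image grid_map_inverse_not_uniformly_continuous by blast
qed

end
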